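(* Let $N\in\mathbb{N}$ and let $F\subseteq \ell_1^N$ be a non-empty finite set. Define $S_F:=\{r\in\mathbb{R} : 0\le r<\mathrm{chg}(F),\ \det FS(r)\neq 0\}$, where $FS(r)$ is the coefficient matrix of the Fragment System of $F$ with parameter $r$. For every $r\in S_F$ let $(\alpha_{p,s}(r))_{(p,s)\in F\times \mathrm{Dir}_N}$ be the unique solution of the Fragment System. Then, for every $r\in S_F$ with $r>0$, the measure $$\omega_{\overline{C}_F(r)} = \Big(\sum_{p\in F}\omega_{\overline{C}_p(r)}\Big)-\sum_{p\in F,\ s\in \mathrm{Dir}_N}\alpha_{p,s}(r)\,\omega_{\mathrm{face}_{p,s}(r)}$$ is the (unique) weight measure of the union of cubes $\overline{C}_F(r)$. It follows that $$\mathrm{mag}\big(\overline{C}_F(r)\big)=\#F\cdot(1+r)^N-\sum_{p\in F,\ s\in \mathrm{Dir}_N}\alpha_{p,s}(r)\,(1+r)^{\mathrm{fdim}_s}.$$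
   Context: $\mathbb{N}=\{0,1,2,\dots\}$. $\ell_1^N$ is $\mathbb{R}^N$ with the metric $d_1(x,y)=\sum_k|x_k-y_k|$; for a set $A$, $d_1(A,x)=d_1(x,A)=\inf_{a\in A}d_1(a,x)$. $\#F$ is the cardinality of $F$. $\mathrm{Dir}_N:=\{-1,0,1\}^N\setminus\{0\}^N$. Cubes and faces: for $p\in\ell_1^N$, $r\ge 0$, $\overline{C}_p(r):=\prod_{k=1}^N[p_k-r,p_k+r]$, and $\overline{C}_F(r):=\bigcup_{p\in F}\overline{C}_p(r)$. Put $L_{-1}=R_{-1}=-1$, $L_0=-1$, $R_0=1$, $L_1=R_1=1$. For $s\in\{-1,0,1\}^N$, $\mathrm{face}_{p,s}(r):=\prod_{k=1}^N[p_k+rL_{s_k},p_k+rR_{s_k}]$, and $\mathrm{fdim}_s$ is the number of zeros among the coordinates of $s$. Coordinate half-gap: $\mathrm{chg}(F):=\infty$ if $\#F\le 1$, and otherwise $\mathrm{chg}(F):=\frac12\min\big(\{|p_k-q_k| : p,q\in F,\ 1\le k\le N\}\setminus\{0\}\big)$. Fragments: for $q\in F$, $u\in\mathrm{Dir}_N$, the $u$-fragment of $F$ at $q$ is $F^{\sqsubset}_{q,u}:=\{p\in F : \mathrm{sgn}(p_k-q_k)=u_k \text{ for all } k\}$. The dotted $u$-fragment of $F$ at $q$ is $\mathrm{df}(F)_{q,u}:=\{(p,s)\in F\times\mathrm{Dir}_N : \mathrm{sgn}(p_k+g s_k-q_k)=u_k\text{ for all }k\}$, where $g$ is any real number with $0<g<\mathrm{chg}(F)$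 (for $q\in F$ the set does not depend on the choice of $g$). Fragment System (for real $r$ with $0\le r<\mathrm{chg}(F)$): the system of $\#F\cdot(3^N-1)$ linear equations in the unknowns $(x_{p,s})_{(p,s)\in F\times\mathrm{Dir}_N}$, indexed by $(q,u)\in F\times\mathrm{Dir}_N$, $$\sum_{(p,s)\in\mathrm{df}(F)_{q,u}}x_{p,s}\,e^{-d_1(\mathrm{face}_{p,s}(r),\,q+ru)}=\sum_{p\in F^{\sqsubset}_{q,u}}e^{-d_1(\overline{C}_p(r),\,q+ru)}.$$ $FS(r)$ denotes its (square) coefficient matrix. Weight measures and magnitude: a weight measure of a compact $K\subseteq\ell_1^N$ is a finite signed Borel measure $\omega$ on $K$ with $\int_K e^{-d_1(x,a)}\,d\omega(x)=1$ for all $a\in K$; it is unique if it exists and is denoted $\omega_K$; then $\mathrm{mag}(K):=\omega_K(K)$. Measures on subsets of $\ell_1^N$ are extended by zero to $\ell_1^N$. Each cube and each face has a weight measure: for a product of compact intervals $\prod_k[a_k,b_k]$ (with $a_k\le b_k$) it is the product measure of the $\frac12(\delta_{a_k}+\lambda_{[a_k,b_k]}+\delta_{b_k})$, with $\lambda$ Lebesgue measure and $\delta$ Dirac measure. *)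

theory Defs
  imports "HOL-Analysis.Analysis" "Jordan_Normal_Form.Determinant"
begin

text \<open>
  The dimension \<open>N\<close> is an arbitrary natural number, \<open>0\<close> included, so points of \<open>\<real>\<^sup>N\<close> are
  extensional functions on \<open>{..<N}\<close> and coordinates are numbered from \<open>0\<close>. On this carrier the
  metric \<open>d1\<close> induces the product topology, and the Borel sets are those of the product
  sigma-algebra.
\<close>

definition pts :: "nat \<Rightarrow> (nat \<Rightarrow> real) set" where
  "pts N = {..<N} \<rightarrow>\<^sub>E UNIV"

definition l1_top :: "nat \<Rightarrow> (nat \<Rightarrow> real) topology" where
  "l1_top N = product_topology (\<lambda>_. euclideanreal) {..<N}"

definition l1_borel :: "nat \<Rightarrow> (nat \<Rightarrow> real) measure" where
  "l1_borel N = (\<Pi>\<^sub>M k\<in>{..<N}. borel)"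

definition d1 :: "nat \<Rightarrow> (nat \<Rightarrow> real) \<Rightarrow> (nat \<Rightarrow> real) \<Rightarrow> real" where
  "d1 N x y = (\<Sum>k<N. \<bar>x k - y k\<bar>)"

definition d1_set :: "nat \<Rightarrow> (nat \<Rightarrow> real) set \<Rightarrow> (nat \<Rightarrow> real) \<Rightarrow> real" where
  "d1_set N A x = (INF a\<in>A. d1 N a x)"

definition Dir :: "nat \<Rightarrow> (nat \<Rightarrow> real) set" where
  "Dir N = ({..<N} \<rightarrow>\<^sub>E {-1, 0, 1}) - ({..<N} \<rightarrow>\<^sub>E {0})"


subsection \<open>Cubes and faces\<close>

definition cube :: "nat \<Rightarrow> (nat \<Rightarrow> real) \<Rightarrow> real \<Rightarrow> (nat \<Rightarrow> real) set" where
  "cube N p r = (\<Pi>\<^sub>E k\<in>{..<N}. {p k - r .. p k + r})"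

definition cubes :: "nat \<Rightarrow> (nat \<Rightarrow> real) set \<Rightarrow> real \<Rightarrow> (nat \<Rightarrow> real) set" where
  "cubes N F r = (\<Union>p\<in>F. cube N p r)"

definition Lf :: "real \<Rightarrow> real" where
  "Lf t = (if t = 1 then 1 else -1)"

definition Rf :: "real \<Rightarrow> real" where
  "Rf t = (if t = -1 then -1 else 1)"

definition face :: "nat \<Rightarrow> (nat \<Rightarrow> real) \<Rightarrow> (nat \<Rightarrow> real) \<Rightarrow> real \<Rightarrow> (nat \<Rightarrow> real) set" where
  "face N p s r = (\<Pi>\<^sub>E k\<in>{..<N}. {p k + r * Lf (s k) .. p k + r * Rf (s k)})"

definition fdim :: "nat \<Rightarrow> (nat \<Rightarrow> real) \<Rightarrow> nat" where
  "fdim N s = card {k. k < N \<and> s k = 0}"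


subsection \<open>The Fragment System\<close>

definition chg :: "nat \<Rightarrow> (nat \<Rightarrow> real) set \<Rightarrow> ereal" where
  "chg N F = (if card F \<le> 1 then \<infinity>
     else ereal (1/2 * Min ({\<bar>p k - q k\<bar> | p q k. p \<in> F \<and> q \<in> F \<and> k < N} - {0})))"

definition fragment ::
  "nat \<Rightarrow> (nat \<Rightarrow> real) set \<Rightarrow> (nat \<Rightarrow> real) \<Rightarrow> (nat \<Rightarrow> real) \<Rightarrow> (nat \<Rightarrow> real) set" where
  "fragment N F q u = {p \<in> F. \<forall>k<N. sgn (p k - q k) = u k}"

text \<open>
  For \<open>q \<in> F\<close> the dotted fragment does not depend on the choice of \<open>g\<close> in the open interval from \<open>0\<close> to
  \<open>chg N F\<close>, which is non-empty for finite \<open>F\<close>.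
\<close>

definition dotted_fragment ::
  "nat \<Rightarrow> (nat \<Rightarrow> real) set \<Rightarrow> (nat \<Rightarrow> real) \<Rightarrow> (nat \<Rightarrow> real)
     \<Rightarrow> ((nat \<Rightarrow> real) \<times> (nat \<Rightarrow> real)) set" where
  "dotted_fragment N F q u =
     (let g = (SOME g::real. 0 < g \<and> ereal g < chg N F)
      in {(p, s) \<in> F \<times> Dir N. \<forall>k<N. sgn (p k + g * s k - q k) = u k})"

definition corner :: "nat \<Rightarrow> (nat \<Rightarrow> real) \<Rightarrow> (nat \<Rightarrow> real) \<Rightarrow> real \<Rightarrow> (nat \<Rightarrow> real)" where
  "corner N q u r = (\<lambda>k\<in>{..<N}. q k + r * u k)"

definition solves_fragment_system ::
  "nat \<Rightarrow> (nat \<Rightarrow> real) set \<Rightarrow> real \<Rightarrow> ((nat \<Rightarrow> real) \<times> (nat \<Rightarrow> real) \<Rightarrow> real) \<Rightarrow> bool" where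
  "solves_fragment_system N F r x \<longleftrightarrow>
     (\<forall>(q, u) \<in> F \<times> Dir N.
        (\<Sum>(p, s) \<in> dotted_fragment N F q u.
           x (p, s) * exp (- d1_set N (face N p s r) (corner N q u r)))
        = (\<Sum>p \<in> fragment N F q u. exp (- d1_set N (cube N p r) (corner N q u r))))"

definition FS_entry ::
  "nat \<Rightarrow> (nat \<Rightarrow> real) set \<Rightarrow> real \<Rightarrow> (nat \<Rightarrow> real) \<times> (nat \<Rightarrow> real)
     \<Rightarrow> (nat \<Rightarrow> real) \<times> (nat \<Rightarrow> real) \<Rightarrow> real" where
  "FS_entry N F r = (\<lambda>(q, u) (p, s).
     if (p, s) \<in> dotted_fragment N F q u
     then exp (- d1_set N (face N p s r) (corner N q u r)) else 0)"

text \<open>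
  Library matrices are indexed by numbers, so the index set \<open>F \<times> Dir N\<close> is enumerated, in the same
  order for rows and columns; the determinant does not depend on the enumeration.
\<close>

definition FS :: "nat \<Rightarrow> (nat \<Rightarrow> real) set \<Rightarrow> real \<Rightarrow> real mat" where
  "FS N F r = (let n = card (F \<times> Dir N); e = from_nat_into (F \<times> Dir N)
     in mat n n (\<lambda>(i, j). FS_entry N F r (e i) (e j)))"

definition S_set :: "nat \<Rightarrow> (nat \<Rightarrow> real) set \<Rightarrow> real set" where
  "S_set N F = {r. 0 \<le> r \<and> ereal r < chg N F \<and> Determinant.det (FS N F r) \<noteq> 0}"

text \<open>
  A solution is a family indexed by \<open>F \<times> Dir N\<close>; extensionality makes it unique as a total function.
\<close>

definition fs_solution ::
  "nat \<Rightarrow> (nat \<Rightarrow> real) set \<Rightarrow> real \<Rightarrow> (nat \<Rightarrow> real) \<times> (nat \<Rightarrow> real) \<Rightarrow> real" where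
  "fs_solution N F r = (THE x. x \<in> extensional (F \<times> Dir N) \<and> solves_fragment_system N F r x)"


subsection \<open>Signed measures\<close>

text \<open>
  A finite signed measure is a real-valued, countably additive set function. As for the library's
  type of measures, its value on non-measurable sets is fixed to be \<open>0\<close>, so that two signed measures are
  equal as functions as soon as they agree on the measurable sets.
\<close>

definition finite_signed_measure :: "'a measure \<Rightarrow> ('a set \<Rightarrow> real) \<Rightarrow> bool" where
  "finite_signed_measure M \<omega> \<longleftrightarrow>
     \<omega> {} = 0 \<and>
     (\<forall>A. A \<notin> sets M \<longrightarrow> \<omega> A = 0) \<and>
     (\<forall>A::nat \<Rightarrow> 'a set. range A \<subseteq> sets M \<longrightarrow> disjoint_family A \<longrightarrow>
        (\<lambda>i. \<omega> (A i)) sums \<omega> (\<Union>i. A i))"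

text \<open>
  The positive part of the Jordan decomposition; the negative part of \<open>\<omega>\<close> is the positive part of \<open>-\<omega>\<close>.
\<close>

definition pos_part :: "'a measure \<Rightarrow> ('a set \<Rightarrow> real) \<Rightarrow> 'a measure" where
  "pos_part M \<omega> = measure_of (space M) (sets M)
     (\<lambda>A. SUP B\<in>{B \<in> sets M. B \<subseteq> A}. ennreal (\<omega> B))"

definition signed_integral :: "'a measure \<Rightarrow> ('a set \<Rightarrow> real) \<Rightarrow> ('a \<Rightarrow> real) \<Rightarrow> real" where
  "signed_integral M \<omega> f =
     (\<integral>x. f x \<partial>pos_part M \<omega>) - (\<integral>x. f x \<partial>pos_part M (\<lambda>A. - \<omega> A))"


subsection \<open>Weight measures and magnitude\<close>

text \<open>
  A signed measure on \<open>K\<close> is identified with its extension by zero, that is, with a signed measure on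
  the whole space that is concentrated on \<open>K\<close>.
\<close>

definition is_weight_measure ::
  "nat \<Rightarrow> (nat \<Rightarrow> real) set \<Rightarrow> ((nat \<Rightarrow> real) set \<Rightarrow> real) \<Rightarrow> bool" where
  "is_weight_measure N K \<omega> \<longleftrightarrow>
     compactin (l1_top N) K \<and>
     finite_signed_measure (l1_borel N) \<omega> \<and>
     (\<forall>A \<in> sets (l1_borel N). \<omega> A = \<omega> (A \<inter> K)) \<and>
     (\<forall>a\<in>K. signed_integral (l1_borel N) \<omega> (\<lambda>x. exp (- d1 N x a)) = 1)"

definition weight_measure ::
  "nat \<Rightarrow> (nat \<Rightarrow> real) set \<Rightarrow> (nat \<Rightarrow> real) set \<Rightarrow> real" where
  "weight_measure N K = (THE \<omega>. is_weight_measure N K \<omega>)"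

definition mag :: "nat \<Rightarrow> (nat \<Rightarrow> real) set \<Rightarrow> real" where
  "mag N K = weight_measure N K K"

end

theory Submission
  imports Defs
begin

text \<open>
  The kernel \<open>exp (- \<bar>x - y\<bar>)\<close> equals \<open>\<integral> 2 \<phi>\<^sub>t(x) \<phi>\<^sub>t(y) dt\<close> with \<open>\<phi>\<^sub>t(x) = exp (x - t)\<close> for \<open>x \<le> t\<close>
  and \<open>0\<close> otherwise. Taking products, the energy of a signed measure is the square of an \<open>L\<^sup>2\<close> norm, and
  if it vanishes then the measure vanishes on all lower orthants. This gives uniqueness of weight
  measures.

  For existence, let \<open>y\<close> lie in the cube of \<open>q \<in> F\<close>. As \<open>r < chg(F)\<close>, the coordinate intervals of two
  cubes coincide or are disjoint, so in passing from a corner \<open>q + r u\<close> to \<open>y\<close> the potential of every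
  cube and every face in the \<open>u\<close>-direction gets multiplied by one and the same factor, which depends only
  on \<open>u\<close> and \<open>y - q\<close>. The Fragment System says that these potentials cancel at the corners, hence they
  cancel at \<open>y\<close>, and only the potential \<open>1\<close> of the cube of \<open>q\<close> itself remains.
\<close>

section \<open>Finite signed measures\<close>

text \<open>Integrals against a signed measure go through \<open>pos_part\<close>, and the positive
  part of a difference is not the difference of the positive parts. Additivity of
  \<open>signed_integral\<close> is therefore derived from equality of values on sets, and
  finiteness of the parts from boundedness of a real-valued countably additive set function.

  The functions \<open>half_exp t\<close> are one-sided for a reason: up to a factor depending on
  \<open>t\<close> only, their product is the exponential of the coordinate sum on a lower orthant
  and 0 off it. Integrals against these products are thus orthant masses of a measure with a
  positive density. Vanishing energy gives equality for almost every \<open>t\<close> only;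
  right-continuity in \<open>t\<close> supplies the rest.

  The common factor in the existence half is one-dimensional. Where \<open>u k\<close> is 1 or -1,
  moving from the corner to \<open>y\<close> adds \<open>r - u k * (y k - q k)\<close> to the
  distance from every interval concerned; where \<open>u k = 0\<close>, both distances are 0. Among
  all cubes and faces, only the cube of \<open>q\<close> has direction 0 as seen from
  \<open>q\<close>, so exactly one term is not covered by the equations.\<close>

lemma finite_signed_measure_sums:
  fixes A :: "nat \<Rightarrow> 'a set"
  assumes "finite_signed_measure M \<omega>" "\<And>i. A i \<in> sets M" "disjoint_family A"
  shows "(\<lambda>i. \<omega> (A i)) sums \<omega> (\<Union>i. A i)"
  using assms unfolding finite_signed_measure_def by (metis image_subsetI)

lemma finite_signed_measure_Un:
  assumes "finite_signed_measure M \<omega>" "A \<in> sets M" "B \<in> sets M" "A \<inter> B = {}"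
  shows "\<omega> (A \<union> B) = \<omega> A + \<omega> B"
proof -
  have s: "(\<lambda>i. \<omega> (binaryset A B i)) sums \<omega> (\<Union>i. binaryset A B i)"
    using assms
    by (intro finite_signed_measure_sums[OF assms(1)]) (auto simp: disjoint_family_on_def binaryset_def)
  have "(\<lambda>i. \<omega> (binaryset A B i)) sums (\<Sum>i<2. \<omega> (binaryset A B i))"
    using assms by (intro sums_finite) (auto simp: binaryset_def finite_signed_measure_def)
  with s show ?thesis
    by (simp add: UN_binaryset_eq sums_unique2 binaryset_def numeral_2_eq_2)
qed

lemma finite_signed_measure_scale:
  assumes "finite_signed_measure M \<omega>"
  shows "finite_signed_measure M (\<lambda>A. c * \<omega> A)"
  using assms unfolding finite_signed_measure_def by (auto intro: sums_mult)

lemma finite_signed_measure_sum: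
  assumes "\<And>i. i \<in> I \<Longrightarrow> finite_signed_measure M (\<omega> i)"
  shows "finite_signed_measure M (\<lambda>A. \<Sum>i\<in>I. \<omega> i A)"
  using assms unfolding finite_signed_measure_def by (auto intro!: sums_sum)

lemma finite_signed_measure_diff:
  assumes "finite_signed_measure M \<omega>" "finite_signed_measure M \<eta>"
  shows "finite_signed_measure M (\<lambda>A. \<omega> A - \<eta> A)"
  using assms unfolding finite_signed_measure_def by (auto intro!: sums_diff)

lemma (in finite_measure) finite_signed_measure_measure:
  "sets N = sets M \<Longrightarrow> finite_signed_measure N (measure M)"
  unfolding finite_signed_measure_def
  by (auto simp: measure_notin_sets intro!: finite_measure_UNION)

text \<open>If the values on the subsets of \<open>E\<close> were unbounded, one could split off from \<open>E\<close>, again and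
  again, a set of mass at least 1 in absolute value, leaving a set with the same property.\<close>

lemma finite_signed_measure_bounded:
  assumes w: "finite_signed_measure M \<omega>"
  obtains C where "\<And>A. A \<in> sets M \<Longrightarrow> \<bar>\<omega> A\<bar> \<le> C"
proof (rule ccontr)
  assume "\<not> thesis"
  define U where "U E \<longleftrightarrow> E \<in> sets M \<and> (\<forall>C. \<exists>A\<in>sets M. A \<subseteq> E \<and> \<bar>\<omega> A\<bar> > C)" for E
  have U0: "U (space M)"
    using \<open>\<not> thesis\<close> that sets.sets_into_space unfolding U_def by (meson not_le sets.top)
  have step: "\<exists>A. A \<in> sets M \<and> A \<subseteq> E \<and> \<bar>\<omega> A\<bar> \<ge> 1 \<and> U (E - A)" if E: "U E" for E
  proof -
    have Em: "E \<in> sets M" using E by (simp add: U_def)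
    \<comment> \<open>Exceeding \<open>1 + \<bar>\<omega> E\<bar>\<close> makes both
      \<open>B\<close> and \<open>E - B\<close> of mass greater than 1 in absolute value, so
      whichever of them keeps unbounded values, the other one can be split off.\<close>
    obtain B where B: "B \<in> sets M" "B \<subseteq> E" "\<bar>\<omega> B\<bar> > 1 + \<bar>\<omega> E\<bar>"
      using E unfolding U_def by blast
    have "\<omega> (B \<union> (E - B)) = \<omega> B + \<omega> (E - B)"
      using B Em by (intro finite_signed_measure_Un[OF w]) auto
    then have e: "\<omega> E = \<omega> B + \<omega> (E - B)" using B by (simp add: Un_absorb1)
    have "U (E - B) \<or> U B"
    proof (rule ccontr)
      assume "\<not> (U (E - B) \<or> U B)"
      then have "\<not> U (E - B)" "\<not> U B" by auto
      obtain C1 where C1: "\<forall>A\<in>sets M. A \<subseteq> E - B \<longrightarrow> \<not> \<bar>\<omega> A\<bar> > C1"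
        using \<open>\<not> U (E - B)\<close> sets.Diff[OF Em B(1)] unfolding U_def by blast
      obtain C2 where C2: "\<forall>A\<in>sets M. A \<subseteq> B \<longrightarrow> \<not> \<bar>\<omega> A\<bar> > C2"
        using \<open>\<not> U B\<close> B(1) unfolding U_def by blast
      obtain A where A: "A \<in> sets M" "A \<subseteq> E" "\<bar>\<omega> A\<bar> > C1 + C2"
        using E unfolding U_def by blast
      have "\<omega> ((A - B) \<union> (A \<inter> B)) = \<omega> (A - B) + \<omega> (A \<inter> B)"
        using B A by (intro finite_signed_measure_Un[OF w]) auto
      moreover have "\<not> \<bar>\<omega> (A - B)\<bar> > C1"
        using C1 sets.Diff[OF A(1) B(1)] A(2) by blast
      moreover have "\<not> \<bar>\<omega> (A \<inter> B)\<bar> > C2"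
        using C2 sets.Int[OF A(1) B(1)] by blast
      ultimately show False using A(3) by (simp add: Un_Diff_Int)
    qed
    then show ?thesis
    proof
      assume "U (E - B)"
      then show ?thesis using B by (intro exI[of _ B]) auto
    next
      assume "U B"
      then show ?thesis using B Em e by (intro exI[of _ "E - B"]) (auto simp: double_diff)
    qed
  qed
  then obtain S where S: "\<And>E. U E \<Longrightarrow> S E \<in> sets M \<and> S E \<subseteq> E \<and> \<bar>\<omega> (S E)\<bar> \<ge> 1 \<and> U (E - S E)"
    by metis
  define E where "E n = ((\<lambda>E. E - S E) ^^ n) (space M)" for n :: nat
  have ES: "E (Suc n) = E n - S (E n)" for n by (simp add: E_def)
  have EU: "U (E n)" for n
    by (induction n) (auto simp: ES U0 S, simp add: E_def U0)
  have sub: "E m \<subseteq> E n" if "n \<le> m" for m n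
    using that by (induction rule: dec_induct) (auto simp: ES)
  have disj: "S (E n) \<inter> S (E m) = {}" if "n < m" for m n
  proof -
    have "S (E m) \<subseteq> E m" using S[OF EU] by blast
    also have "E m \<subseteq> E (Suc n)" using sub that by simp
    finally show ?thesis by (auto simp: ES)
  qed
  then have "disjoint_family (\<lambda>n. S (E n))"
    unfolding disjoint_family_on_def by (metis Int_commute linorder_neqE_nat)
  then have "(\<lambda>n. \<omega> (S (E n))) sums \<omega> (\<Union>n. S (E n))"
    using S[OF EU] by (intro finite_signed_measure_sums[OF w]) auto
  \<comment> \<open>The terms of a convergent series tend to 0, whereas every split-off set has mass
    at least 1 in absolute value.\<close>
  then have "(\<lambda>n. \<omega> (S (E n))) \<longlonglongrightarrow> 0"
    using sums_summable summable_LIMSEQ_zero by blast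
  then have "\<forall>\<^sub>F n in sequentially. \<bar>\<omega> (S (E n))\<bar> < 1"
    by (simp add: tendsto_iff dist_real_def)
  then obtain n where "\<bar>\<omega> (S (E n))\<bar> < 1"
    by (meson eventually_sequentially le_refl)
  then show False
    using S[OF EU, of n] by simp
qed

text \<open>\<open>measure_of\<close> takes the prescribed values only if these are countably
  additive. For the supremum, one inequality follows from superadditivity and monotonicity, the
  other from cutting a competitor \<open>B\<close> into the pieces
  \<open>B \<inter> A i\<close>.\<close>

lemma emeasure_pos_part:
  assumes w: "finite_signed_measure M \<omega>" and A: "A \<in> sets M"
  shows "emeasure (pos_part M \<omega>) A = (SUP B\<in>{B \<in> sets M. B \<subseteq> A}. ennreal (\<omega> B))"
  unfolding pos_part_def
proof (rule emeasure_measure_of_sigma[OF sets.sigma_algebra_axioms _ _ A])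
  let ?\<mu> = "\<lambda>A. SUP B\<in>{B \<in> sets M. B \<subseteq> A}. ennreal (\<omega> B)"
  have w0: "\<omega> {} = 0" using w by (simp add: finite_signed_measure_def)
  have "{B \<in> sets M. B \<subseteq> {}} = {{}}" by auto
  then have mu0: "?\<mu> {} = 0" using w0 by simp
  then show "positive (sets M) ?\<mu>" by (simp add: positive_def)
  have mono: "?\<mu> A \<le> ?\<mu> B" if "A \<subseteq> B" for A B
    using that by (intro SUP_subset_mono) auto
  have super: "?\<mu> A + ?\<mu> B \<le> ?\<mu> (A \<union> B)" if "A \<inter> B = {}" for A B
  proof -
    have ne: "{X \<in> sets M. X \<subseteq> A} \<noteq> {}" for A by (auto intro!: exI[of _ "{}"])
    have "?\<mu> A + ?\<mu> B = (SUP Y\<in>{X \<in> sets M. X \<subseteq> B}. SUP X\<in>{B \<in> sets M. B \<subseteq> A}. ennreal (\<omega> X) + ennreal (\<omega> Y))"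
      by (simp only: ennreal_SUP_add_right[OF ne] ennreal_SUP_add_left[OF ne, symmetric])
    also have "\<dots> \<le> ?\<mu> (A \<union> B)"
    proof (intro SUP_least)
      fix X Y assume X: "X \<in> {B \<in> sets M. B \<subseteq> A}" and Y: "Y \<in> {X \<in> sets M. X \<subseteq> B}"
      have XY: "\<omega> (X \<union> Y) = \<omega> X + \<omega> Y"
        using X Y that by (intro finite_signed_measure_Un[OF w]) auto
      have up: "ennreal (\<omega> Z) \<le> ?\<mu> (A \<union> B)" if "Z \<in> {X, Y, X \<union> Y}" for Z
        using X Y that by (intro SUP_upper) auto
      show "ennreal (\<omega> X) + ennreal (\<omega> Y) \<le> ?\<mu> (A \<union> B)"
      \<comment> \<open>\<open>ennreal\<close> sends negative numbers to 0, so if one of the two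
        masses is negative, the other set alone is already a good enough competitor.\<close>
      proof (cases "\<omega> X \<ge> 0 \<and> \<omega> Y \<ge> 0")
        case True
        then show ?thesis using up[of "X \<union> Y"] XY by simp
      next
        case False
        then show ?thesis using up[of X] up[of Y] by (auto simp: not_le ennreal_neg)
      qed
    qed
    finally show ?thesis .
  qed
  show "countably_additive (sets M) ?\<mu>"
  proof (rule countably_additiveI)
    fix A :: "nat \<Rightarrow> 'a set"
    assume A: "range A \<subseteq> sets M" "disjoint_family A"
    show "(\<Sum>i. ?\<mu> (A i)) = ?\<mu> (\<Union>i. A i)"
    proof (rule antisym)
      have le: "(\<Sum>i<n. ?\<mu> (A i)) \<le> ?\<mu> (\<Union>i<n. A i)" for n
      proof (induction n)
        case (Suc n)
        have "(\<Sum>i<Suc n. ?\<mu> (A i)) \<le> ?\<mu> (\<Union>i<n. A i) + ?\<mu> (A n)"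
          using Suc by (simp add: add_right_mono)
        also have "\<dots> \<le> ?\<mu> ((\<Union>i<n. A i) \<union> A n)"
        proof (rule super)
          have "A i \<inter> A n = {}" if "i < n" for i
            using A(2) that by (simp add: disjoint_family_on_def)
          then show "(\<Union>i<n. A i) \<inter> A n = {}" by blast
        qed
        also have "(\<Union>i<n. A i) \<union> A n = (\<Union>i<Suc n. A i)"
          by (simp add: lessThan_Suc Un_commute)
        finally show ?case .
      next
        case 0
        then show ?case by simp
      qed
      have le': "?\<mu> (\<Union>i<n. A i) \<le> ?\<mu> (\<Union>i. A i)" for n
        by (rule mono) blast
      show "(\<Sum>i. ?\<mu> (A i)) \<le> ?\<mu> (\<Union>i. A i)"
        unfolding suminf_eq_SUP by (rule SUP_least, rule order_trans[OF le le'])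
      show "?\<mu> (\<Union>i. A i) \<le> (\<Sum>i. ?\<mu> (A i))"
      proof (rule SUP_least)
        fix B assume B: "B \<in> {B \<in> sets M. B \<subseteq> (\<Union>i. A i)}"
        have "(\<lambda>i. \<omega> (B \<inter> A i)) sums \<omega> (\<Union>i. B \<inter> A i)"
        proof (rule finite_signed_measure_sums[OF w])
          show "B \<inter> A i \<in> sets M" for i using A(1) B by blast
          show "disjoint_family (\<lambda>i. B \<inter> A i)"
            by (rule disjoint_family_on_bisimulation[OF A(2)]) blast
        qed
        also have "(\<Union>i. B \<inter> A i) = B" using B by auto
        finally have "(\<lambda>n. ennreal (\<Sum>i<n. \<omega> (B \<inter> A i))) \<longlonglongrightarrow> ennreal (\<omega> B)"
          unfolding sums_def by (rule tendsto_ennrealI)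
        then show "ennreal (\<omega> B) \<le> (\<Sum>i. ?\<mu> (A i))"
        proof (rule LIMSEQ_le_const2, intro exI allI impI)
          fix n
          \<comment> \<open>\<open>ennreal\<close> is additive only on nonnegative numbers, so
            negative masses are first raised to 0.\<close>
          have "ennreal (\<Sum>i<n. \<omega> (B \<inter> A i)) \<le> ennreal (\<Sum>i<n. max 0 (\<omega> (B \<inter> A i)))"
            by (intro ennreal_leI sum_mono) auto
          also have "\<dots> = (\<Sum>i<n. ennreal (\<omega> (B \<inter> A i)))"
            by (subst sum_ennreal[symmetric]) (auto simp: ennreal_max_0)
          also have "\<dots> \<le> (\<Sum>i<n. ?\<mu> (A i))"
            using A B by (intro sum_mono SUP_upper) auto
          also have "\<dots> \<le> (\<Sum>i. ?\<mu> (A i))"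
            by (rule sum_le_suminf) auto
          finally show "ennreal (\<Sum>i<n. \<omega> (B \<inter> A i)) \<le> (\<Sum>i. ?\<mu> (A i))" .
        qed
      qed
    qed
  qed
qed

lemma sets_pos_part [simp]: "sets (pos_part M \<omega>) = sets M"
  by (simp add: pos_part_def)

lemma space_pos_part [simp]: "space (pos_part M \<omega>) = space M"
  by (simp add: pos_part_def space_measure_of_conv)

lemma finite_measure_pos_part:
  assumes w: "finite_signed_measure M \<omega>"
  shows "finite_measure (pos_part M \<omega>)"
proof
  obtain C where C: "\<And>A. A \<in> sets M \<Longrightarrow> \<bar>\<omega> A\<bar> \<le> C"
    using finite_signed_measure_bounded[OF w] by blast
  have "emeasure (pos_part M \<omega>) (space M) \<le> ennreal C"
    unfolding emeasure_pos_part[OF w sets.top]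
    by (rule SUP_least) (use C in \<open>force intro: ennreal_leI\<close>)
  then show "emeasure (pos_part M \<omega>) (space (pos_part M \<omega>)) \<noteq> \<infinity>"
    by (auto simp: top_unique)
qed

lemma finite_signed_measure_uminus:
  "finite_signed_measure M \<omega> \<Longrightarrow> finite_signed_measure M (\<lambda>A. - \<omega> A)"
  using finite_signed_measure_scale[of M \<omega> "-1"] by simp

lemma pos_part_upper:
  assumes w: "finite_signed_measure M \<omega>" and "A \<in> sets M" "B \<in> sets M" "B \<subseteq> A"
  shows "\<omega> B \<le> measure (pos_part M \<omega>) A"
proof -
  interpret finite_measure "pos_part M \<omega>" by (rule finite_measure_pos_part[OF w])
  have "ennreal (\<omega> B) \<le> emeasure (pos_part M \<omega>) A"
    unfolding emeasure_pos_part[OF w assms(2)] using assms by (intro SUP_upper) auto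
  then show ?thesis by (simp add: emeasure_eq_measure ennreal_le_iff)
qed

lemma pos_part_least:
  assumes w: "finite_signed_measure M \<omega>" and "A \<in> sets M"
    and "\<And>B. B \<in> sets M \<Longrightarrow> B \<subseteq> A \<Longrightarrow> \<omega> B \<le> c"
  shows "measure (pos_part M \<omega>) A \<le> c"
proof -
  interpret finite_measure "pos_part M \<omega>" by (rule finite_measure_pos_part[OF w])
  have "0 \<le> c" using assms(3)[of "{}"] w by (simp add: finite_signed_measure_def)
  have "emeasure (pos_part M \<omega>) A \<le> ennreal c"
    unfolding emeasure_pos_part[OF w assms(2)] using assms(3) by (intro SUP_least ennreal_leI) auto
  then show ?thesis using \<open>0 \<le> c\<close> by (simp add: emeasure_eq_measure ennreal_le_iff)
qed

text \<open>Complementation inside \<open>A\<close> exchanges the two suprema up to a constant: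
  \<open>\<omega> B = \<omega> A + (- \<omega> (A - B))\<close>.\<close>

lemma Jordan_decomposition:
  assumes w: "finite_signed_measure M \<omega>" and A: "A \<in> sets M"
  shows "\<omega> A = measure (pos_part M \<omega>) A - measure (pos_part M (\<lambda>A. - \<omega> A)) A"
proof -
  note w' = finite_signed_measure_uminus[OF w]
  have split: "\<omega> A = \<omega> B + \<omega> (A - B)" if "B \<in> sets M" "B \<subseteq> A" for B
    using finite_signed_measure_Un[OF w, of B "A - B"] that A by (simp add: Un_absorb1)
  have "measure (pos_part M \<omega>) A \<le> \<omega> A + measure (pos_part M (\<lambda>A. - \<omega> A)) A"
  proof (rule pos_part_least[OF w A])
    fix B assume B: "B \<in> sets M" "B \<subseteq> A"
    have "- \<omega> (A - B) \<le> measure (pos_part M (\<lambda>A. - \<omega> A)) A"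
      using A B by (intro pos_part_upper[OF w']) auto
    then show "\<omega> B \<le> \<omega> A + measure (pos_part M (\<lambda>A. - \<omega> A)) A" using split[OF B] by simp
  qed
  moreover have "measure (pos_part M (\<lambda>A. - \<omega> A)) A \<le> measure (pos_part M \<omega>) A - \<omega> A"
  proof (rule pos_part_least[OF w' A])
    fix B assume B: "B \<in> sets M" "B \<subseteq> A"
    have "\<omega> (A - B) \<le> measure (pos_part M \<omega>) A"
      using A B by (intro pos_part_upper[OF w]) auto
    then show "- \<omega> B \<le> measure (pos_part M \<omega>) A - \<omega> A" using split[OF B] by simp
  qed
  ultimately show ?thesis by simp
qed

section \<open>Integration against linear combinations of finite measures\<close>

lemma (in finite_measure) integrable_bounded_real:
  fixes f :: "'a \<Rightarrow> real"
  shows "f \<in> borel_measurable M \<Longrightarrow> (\<And>x. x \<in> space M \<Longrightarrow> \<bar>f x\<bar> \<le> B) \<Longrightarrow> integrable M f"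
  by (rule integrable_const_bound[where B = B]) auto

text \<open>Two representations of one signed measure integrate bounded functions alike. The
  indicator case is the hypothesis; linearity and dominated convergence carry it to nonnegative
  bounded functions, and a shift by a constant to all bounded ones.\<close>

lemma integral_eq_if_measure_eq:
  fixes f :: "'a \<Rightarrow> real" and c :: "'i \<Rightarrow> real"
  assumes fin: "\<And>i. i \<in> I \<Longrightarrow> finite_measure (m i)" and sets: "\<And>i. i \<in> I \<Longrightarrow> sets (m i) = sets M"
    and P: "finite_measure P" "sets P = sets M" and Q: "finite_measure Q" "sets Q = sets M"
    and eq: "\<And>A. A \<in> sets M \<Longrightarrow> (\<Sum>i\<in>I. c i * measure (m i) A) = measure P A - measure Q A"
    and f: "f \<in> borel_measurable M" and B: "\<And>x. x \<in> space M \<Longrightarrow> \<bar>f x\<bar> \<le> B"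
  shows "(\<Sum>i\<in>I. c i * (\<integral>x. f x \<partial>m i)) = (\<integral>x. f x \<partial>P) - (\<integral>x. f x \<partial>Q)"
proof -
  define R where "R g \<longleftrightarrow> (\<Sum>i\<in>I. c i * (\<integral>x. g x \<partial>m i)) = (\<integral>x. g x \<partial>P) - (\<integral>x. g x \<partial>Q)" for g
  have meas: "g \<in> borel_measurable (m i)" if "g \<in> borel_measurable M" "i \<in> I" for g :: "'a \<Rightarrow> real" and i
    using that sets measurable_cong_sets by blast
  have measP: "g \<in> borel_measurable P" and measQ: "g \<in> borel_measurable Q"
    if "g \<in> borel_measurable M" for g :: "'a \<Rightarrow> real"
    using that P Q measurable_cong_sets by blast+
  have sp: "space P = space M" "space Q = space M" "\<And>i. i \<in> I \<Longrightarrow> space (m i) = space M"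
    by (rule sets_eq_imp_space_eq; simp add: P Q sets)+
  have int: "integrable (m i) g"
    if "g \<in> borel_measurable M" "\<And>x. x \<in> space M \<Longrightarrow> \<bar>g x\<bar> \<le> C" "i \<in> I" for g :: "'a \<Rightarrow> real" and C i
    using finite_measure.integrable_bounded_real[OF fin[OF that(3)] meas[OF that(1,3)]] that(2) sp(3)[OF that(3)]
    by metis
  have intP: "integrable P g"
    if "g \<in> borel_measurable M" "\<And>x. x \<in> space M \<Longrightarrow> \<bar>g x\<bar> \<le> C" for g :: "'a \<Rightarrow> real" and C
    using finite_measure.integrable_bounded_real[OF P(1) measP[OF that(1)]] that(2) sp by metis
  have intQ: "integrable Q g"
    if "g \<in> borel_measurable M" "\<And>x. x \<in> space M \<Longrightarrow> \<bar>g x\<bar> \<le> C" for g :: "'a \<Rightarrow> real" and C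
    using finite_measure.integrable_bounded_real[OF Q(1) measQ[OF that(1)]] that(2) sp by metis
  \<comment> \<open>Boundedness is a premise inside the induction because the building blocks handed
    over by the rule carry no bound. Being nonnegative, they inherit one from the function that they
    build.\<close>
  have Rnn: "(\<exists>C. \<forall>x\<in>space M. g x \<le> C) \<longrightarrow> R g" if gm: "g \<in> borel_measurable M" and g0: "\<And>x. 0 \<le> g x" for g :: "'a \<Rightarrow> real"
    using gm g0
  proof (induction rule: borel_measurable_induct_real)
    case (set A)
    then have "A \<inter> space M = A" using sets.sets_into_space by blast
    then have "(\<integral>x. indicator A x \<partial>P) = measure P A" "(\<integral>x. indicator A x \<partial>Q) = measure Q A"
      "\<And>i. i \<in> I \<Longrightarrow> (\<integral>x. indicator A x \<partial>m i) = measure (m i) A"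
      by (simp_all add: sp)
    then show ?case using eq[OF set] by (simp add: R_def)
  next
    case (mult u c')
    have "R (\<lambda>x. c' * u x)" if C: "\<forall>x\<in>space M. c' * u x \<le> C" for C
    proof (cases "c' = 0")
      case False
      then have "\<forall>x\<in>space M. u x \<le> C / c'" using C mult.hyps by (simp add: field_simps)
      then have "R u" using mult.IH by blast
      then show ?thesis
        by (simp add: R_def mult.left_commute sum_distrib_left[symmetric] right_diff_distrib[symmetric])
    qed (simp add: R_def)
    then show ?case by blast
  next
    case (add u v)
    have "R (\<lambda>x. v x + u x)" if C: "\<forall>x\<in>space M. v x + u x \<le> C" for C
    proof -
      have "u x \<le> C" "v x \<le> C" if "x \<in> space M" for x
        using C[rule_format, of x] that add.hyps(2)[of x] add.hyps(4)[of x] by linarith+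
      note le = this
      then have "R u" "R v" using add.IH by blast+
      moreover have ab: "\<bar>u x\<bar> \<le> C" "\<bar>v x\<bar> \<le> C" if "x \<in> space M" for x using that le add.hyps(2,4) by auto
      ultimately show ?thesis
        using add.hyps
        by (simp add: R_def int[OF _ ab(1)] int[OF _ ab(2)] intP[OF _ ab(1)] intP[OF _ ab(2)]
            intQ[OF _ ab(1)] intQ[OF _ ab(2)] distrib_left sum.distrib cong: sum.cong)
    qed
    then show ?case by blast
  next
    case (seq U)
    have "R g" if C: "\<forall>x\<in>space M. g x \<le> C" for C
    proof -
      have Ug: "U n x \<le> U k x" if "n \<le> k" for n k x
        using seq.hyps(3) that by (auto simp: incseq_def le_fun_def)
      have UgC: "U n x \<le> C" if "x \<in> space M" for n x
      proof -
        have "U n x \<le> g x" by (rule LIMSEQ_le_const[OF seq.hyps(4)[OF that]]) (use Ug in blast)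
        then show ?thesis using C that by force
      qed
      have bd: "\<bar>U n x\<bar> \<le> C" if "x \<in> space M" for n x
        using UgC[OF that] seq.hyps(2) by (simp add: abs_le_iff)
      have gbd: "\<bar>g x\<bar> \<le> C" if "x \<in> space M" for x
        using C g0 that by simp
      have RU: "R (U n)" for n using seq.IH UgC by blast
      have "(\<lambda>n. \<integral>x. U n x \<partial>L) \<longlonglongrightarrow> (\<integral>x. g x \<partial>L)"
        if L: "finite_measure L" "sets L = sets M" for L
      proof (rule integral_dominated_convergence[where w = "\<lambda>_. C"])
        have spL: "space L = space M" using L(2) by (rule sets_eq_imp_space_eq)
        show "g \<in> borel_measurable L" "\<And>n. U n \<in> borel_measurable L"
          using gm seq.hyps(1) by (simp_all add: measurable_cong_sets[OF L(2) refl])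
        show "AE x in L. (\<lambda>n. U n x) \<longlonglongrightarrow> g x" by (rule AE_I2) (simp add: spL seq)
        show "AE x in L. norm (U n x) \<le> C" for n by (rule AE_I2) (simp add: spL bd)
        show "integrable L (\<lambda>_. C)" using L(1) by (simp add: finite_measure.integrable_const)
      qed
      note lim = this
      have "(\<lambda>n. \<Sum>i\<in>I. c i * (\<integral>x. U n x \<partial>m i)) \<longlonglongrightarrow> (\<Sum>i\<in>I. c i * (\<integral>x. g x \<partial>m i))"
        by (intro tendsto_sum tendsto_mult_left lim fin sets)
      moreover have "(\<lambda>n. (\<integral>x. U n x \<partial>P) - (\<integral>x. U n x \<partial>Q)) \<longlonglongrightarrow> (\<integral>x. g x \<partial>P) - (\<integral>x. g x \<partial>Q)"
        by (intro tendsto_diff lim P Q)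
      ultimately show ?thesis using RU LIMSEQ_unique by (simp add: R_def)
    qed
    then show ?case by blast
  qed
  \<comment> \<open>The induction rule wants nonnegativity everywhere, but the bound holds on
    \<open>space M\<close> only; the maximum repairs the values outside and changes nothing
    inside.\<close>
  define g where "g x = max 0 (f x + B)" for x
  have g: "g \<in> borel_measurable M" unfolding g_def using f by measurable
  have fB: "0 \<le> f x + B" if "x \<in> space M" for x using B[OF that] by (simp add: abs_le_iff)
  have "\<forall>x\<in>space M. g x \<le> 2 * B"
    using B by (force simp: g_def abs_le_iff)
  moreover have "\<And>x. 0 \<le> g x" by (simp add: g_def)
  ultimately have "R g" using Rnn[OF g] by blast
  have c: "(\<Sum>i\<in>I. c i * measure (m i) (space M)) = measure P (space M) - measure Q (space M)"
    by (rule eq) simp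
  have gi: "(\<integral>x. g x \<partial>L) = (\<integral>x. f x \<partial>L) + B * measure L (space M)"
    if "integrable L f" "finite_measure L" "space L = space M" for L
  proof -
    have "(\<integral>x. g x \<partial>L) = (\<integral>x. f x + B \<partial>L)"
      using fB by (intro Bochner_Integration.integral_cong) (auto simp: g_def that)
    also have "\<dots> = (\<integral>x. f x \<partial>L) + (\<integral>x. B \<partial>L)"
      using that by (intro Bochner_Integration.integral_add) (simp_all add: finite_measure.integrable_const)
    finally show ?thesis by (simp add: that mult.commute)
  qed
  note gi = gi[OF int[OF f B] fin sp(3)] gi[OF intP[OF f B] P(1) sp(1)] gi[OF intQ[OF f B] Q(1) sp(2)]
  have "(\<Sum>i\<in>I. c i * (\<integral>x. f x \<partial>m i)) + B * (\<Sum>i\<in>I. c i * measure (m i) (space M)) =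
    (\<Sum>i\<in>I. c i * (\<integral>x. g x \<partial>m i))"
    by (simp add: gi sum.distrib algebra_simps sum_distrib_left cong: sum.cong)
  also have "\<dots> = (\<integral>x. f x \<partial>P) - (\<integral>x. f x \<partial>Q) + B * (measure P (space M) - measure Q (space M))"
    using \<open>R g\<close> unfolding R_def by (simp add: gi algebra_simps)
  finally show ?thesis using c by simp
qed

text \<open>Frees the signed integral from the Jordan decomposition: any representation by finite
  measures may be used to compute it.\<close>

lemma signed_integral_sum_measures:
  fixes f :: "'a \<Rightarrow> real" and c :: "'i \<Rightarrow> real"
  assumes fin: "\<And>i. i \<in> I \<Longrightarrow> finite_measure (m i)" and sets: "\<And>i. i \<in> I \<Longrightarrow> sets (m i) = sets M"
    and w: "finite_signed_measure M \<omega>"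
    and eq: "\<And>A. A \<in> sets M \<Longrightarrow> \<omega> A = (\<Sum>i\<in>I. c i * measure (m i) A)"
    and f: "f \<in> borel_measurable M" and B: "\<And>x. x \<in> space M \<Longrightarrow> \<bar>f x\<bar> \<le> B"
  shows "signed_integral M \<omega> f = (\<Sum>i\<in>I. c i * (\<integral>x. f x \<partial>m i))"
  unfolding signed_integral_def
  by (rule integral_eq_if_measure_eq[OF fin sets _ _ _ _ _ f B, symmetric])
    (auto simp: eq[symmetric] Jordan_decomposition[OF w, symmetric]
      intro!: finite_measure_pos_part w finite_signed_measure_uminus)

text \<open>The four Jordan parts of \<omega> and \<eta>, with coefficients 1, -1, -1, 1, represent
  the difference, although they are in general not its own Jordan parts.\<close>

lemma signed_integral_diff:
  fixes f :: "'a \<Rightarrow> real"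
  assumes w: "finite_signed_measure M \<omega>" and h: "finite_signed_measure M \<eta>"
    and f: "f \<in> borel_measurable M" and B: "\<And>x. x \<in> space M \<Longrightarrow> \<bar>f x\<bar> \<le> B"
  shows "signed_integral M (\<lambda>A. \<omega> A - \<eta> A) f = signed_integral M \<omega> f - signed_integral M \<eta> f"
proof -
  define m where "m i = [pos_part M \<omega>, pos_part M (\<lambda>A. - \<omega> A), pos_part M \<eta>, pos_part M (\<lambda>A. - \<eta> A)] ! i"
    for i :: nat
  define c :: "nat \<Rightarrow> real" where "c i = [1, -1, -1, 1] ! i" for i
  have "signed_integral M (\<lambda>A. \<omega> A - \<eta> A) f = (\<Sum>i<4. c i * (\<integral>x. f x \<partial>m i))"
  proof (rule signed_integral_sum_measures[OF _ _ finite_signed_measure_diff[OF w h] _ f B])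
    fix i :: nat assume "i \<in> {..<4}"
    then have i: "i = 0 \<or> i = 1 \<or> i = 2 \<or> i = 3" by auto
    show "finite_measure (m i)"
      using i by (auto simp: m_def intro!: finite_measure_pos_part w h finite_signed_measure_uminus)
    show "sets (m i) = sets M" using i by (auto simp: m_def)
  next
    fix A assume A: "A \<in> sets M"
    show "\<omega> A - \<eta> A = (\<Sum>i<4. c i * measure (m i) A)"
      using Jordan_decomposition[OF w A] Jordan_decomposition[OF h A]
      by (simp add: numeral_eq_Suc c_def m_def)
  qed
  then show ?thesis by (simp add: signed_integral_def c_def m_def numeral_eq_Suc)
qed

section \<open>Positive definiteness of the exponential kernel\<close>

definition orthant :: "nat \<Rightarrow> (nat \<Rightarrow> real) \<Rightarrow> (nat \<Rightarrow> real) set" where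
  "orthant N t = {x \<in> pts N. \<forall>k<N. x k \<le> t k}"

lemma space_l1_borel [simp]: "space (l1_borel N) = pts N"
  by (simp add: l1_borel_def pts_def space_PiM)

lemma measurable_l1_borel_component [measurable]:
  "k < N \<Longrightarrow> (\<lambda>x. x k) \<in> borel_measurable (l1_borel N)"
  by (simp add: l1_borel_def)

lemma sets_l1_borel: "sets (l1_borel N) = sigma_sets (pts N) (range (orthant N))"
proof -
  let ?P = "{{f\<in>(\<Pi>\<^sub>E i\<in>{..<N}. UNIV). \<forall>i\<in>j. f i \<in> A i} | A j. j \<in> {{..<N}} \<and> A \<in> Pi j (\<lambda>_::nat. range (\<lambda>a::real. {..a}))}"
  have "sets (l1_borel N) = sets (\<Pi>\<^sub>M i\<in>{..<N}. sigma (UNIV :: real set) (range (\<lambda>a. {..a})))"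
    unfolding l1_borel_def borel_eq_atMost by simp
  also have "\<dots> = sets (sigma (\<Pi>\<^sub>E i\<in>{..<N}. UNIV) ?P)"
  proof (rule sets_PiM_sigma)
    have "UNIV = (\<Union>n::nat. {..real n})"
      using real_arch_simple by blast
    then show "\<exists>S\<subseteq>range (\<lambda>a::real. {..a}). countable S \<and> UNIV = \<Union> S"
      by (intro exI[of _ "range (\<lambda>n::nat. {..real n})"]) auto
  qed auto
  also have "?P = range (orthant N)"
  proof (rule equalityI; rule subsetI)
    fix X assume "X \<in> ?P"
    then obtain A where X: "X = {f\<in>pts N. \<forall>i<N. f i \<in> A i}"
      and A: "A \<in> {..<N} \<rightarrow> range (\<lambda>a::real. {..a})" by (auto simp: pts_def)
    from A have "\<forall>i\<in>{..<N}. \<exists>a. A i = {..a}" by auto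
    then obtain t where "\<forall>i\<in>{..<N}. A i = {..t i}" by metis
    then show "X \<in> range (orthant N)" using X by (auto simp: orthant_def)
  next
    fix X assume "X \<in> range (orthant N)"
    then obtain t where "X = orthant N t" by auto
    then show "X \<in> ?P"
      by (auto simp: orthant_def pts_def intro!: exI[of _ "\<lambda>k. {..t k}"])
  qed
  finally show ?thesis
    by (simp add: pts_def[symmetric] sets_measure_of_conv) (auto simp: orthant_def)
qed

lemma measure_eqI_orthant:
  assumes P: "sets P = sets (l1_borel N)" and Q: "sets Q = sets (l1_borel N)"
    and eq: "\<And>t. emeasure P (orthant N t) = emeasure Q (orthant N t)"
    and fin: "\<And>t. emeasure P (orthant N t) \<noteq> \<infinity>"
  shows "P = Q"
proof (rule measure_eqI_generator_eq)
  have "orthant N s \<inter> orthant N t = orthant N (\<lambda>k. min (s k) (t k))" for s t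
    by (auto simp: orthant_def)
  then show "Int_stable (range (orthant N))" by (auto simp: Int_stable_def)
  show "range (orthant N) \<subseteq> Pow (pts N)" by (auto simp: orthant_def)
  show "range (\<lambda>n::nat. orthant N (\<lambda>_. real n)) \<subseteq> range (orthant N)" by auto
  show "(\<Union>n::nat. orthant N (\<lambda>_. real n)) = pts N"
  proof (intro equalityI subsetI)
    fix x assume x: "x \<in> pts N"
    obtain n :: nat where "Max (insert 0 (x ` {..<N})) \<le> real n" using real_arch_simple by blast
    then have "x \<in> orthant N (\<lambda>_. real n)" using x by (auto simp: orthant_def)
    then show "x \<in> (\<Union>n::nat. orthant N (\<lambda>_. real n))" by blast
  qed (auto simp: orthant_def)
qed (use assms in \<open>auto simp: sets_l1_borel\<close>)

section \<open>Half-line exponentials and the energy of a pair of measures\<close>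

definition half_exp :: "real \<Rightarrow> real \<Rightarrow> real" where
  "half_exp t x = (if x \<le> t then exp (x - t) else 0)"

lemma half_exp_bounds: "0 \<le> half_exp t x" "half_exp t x \<le> 1"
  by (auto simp: half_exp_def)

lemma borel_measurable_half_exp [measurable (raw)]:
  assumes [measurable]: "f \<in> borel_measurable M" "g \<in> borel_measurable M"
  shows "(\<lambda>x. half_exp (f x) (g x)) \<in> borel_measurable M"
  unfolding half_exp_def by measurable

lemma nn_integral_half_exp:
  "(\<integral>\<^sup>+t. ennreal (half_exp t x * half_exp t y) \<partial>lborel) = ennreal (exp (- \<bar>x - y\<bar>) / 2)"
proof -
  have "(\<integral>\<^sup>+t. ennreal (half_exp t x * half_exp t y) \<partial>lborel) =
    (\<integral>\<^sup>+t. ennreal (exp (x + y - 2 * t)) * indicator {max x y..} t \<partial>lborel)"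
    by (intro nn_integral_cong) (auto simp: half_exp_def exp_add[symmetric] split: split_indicator)
  also have "\<dots> = ennreal (0 - (- exp (x + y - 2 * max x y) / 2))"
  proof (rule nn_integral_FTC_atLeast[where F = "\<lambda>t. - exp (x + y - 2 * t) / 2"])
    show "((\<lambda>t. - exp (x + y - 2 * t) / 2) \<longlongrightarrow> 0) at_top" by real_asymp
  qed (auto intro!: derivative_eq_intros)
  also have "x + y - 2 * max x y = - \<bar>x - y\<bar>" by auto
  finally show ?thesis by simp
qed

definition half_exps :: "nat \<Rightarrow> (nat \<Rightarrow> real) \<Rightarrow> (nat \<Rightarrow> real) \<Rightarrow> real" where
  "half_exps N t x = (\<Prod>k<N. half_exp (t k) (x k))"

lemma half_exps_bounds: "0 \<le> half_exps N t x" "half_exps N t x \<le> 1"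
  by (auto simp: half_exps_def half_exp_bounds intro!: prod_nonneg prod_le_1)

lemma exp_minus_d1: "exp (- d1 N x y) = (\<Prod>k<N. exp (- \<bar>x k - y k\<bar>))"
  by (simp add: d1_def exp_sum sum_negf[symmetric])

lemma nn_integral_half_exps:
  "(\<integral>\<^sup>+t. ennreal (half_exps N t x * half_exps N t y) \<partial>(\<Pi>\<^sub>M k\<in>{..<N}. lborel)) =
   ennreal (exp (- d1 N x y) / 2 ^ N)"
proof -
  interpret product_sigma_finite "\<lambda>_::nat. lborel :: real measure" by standard
  have "(\<integral>\<^sup>+t. ennreal (half_exps N t x * half_exps N t y) \<partial>(\<Pi>\<^sub>M k\<in>{..<N}. lborel)) =
    (\<integral>\<^sup>+t. (\<Prod>k<N. ennreal (half_exp (t k) (x k) * half_exp (t k) (y k))) \<partial>(\<Pi>\<^sub>M k\<in>{..<N}. lborel))"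
    by (simp add: half_exps_def prod_ennreal half_exp_bounds prod.distrib)
  also have "\<dots> = (\<Prod>k<N. ennreal (exp (- \<bar>x k - y k\<bar>) / 2))"
    by (subst product_nn_integral_prod) (auto simp: nn_integral_half_exp)
  also have "\<dots> = ennreal (exp (- d1 N x y) / 2 ^ N)"
    by (simp add: prod_ennreal exp_minus_d1 prod_dividef)
  finally show ?thesis .
qed

text \<open>As a function of its parameter, \<open>half_exp\<close> jumps from 0 to 1 at the point
  \<open>x\<close> and takes the value 1 there, so it is continuous from the right only.\<close>

lemma half_exps_tendsto_right:
  assumes "\<And>k n. k < N \<Longrightarrow> t k < s n k" and "\<And>k. k < N \<Longrightarrow> (\<lambda>n. s n k) \<longlonglongrightarrow> t k"
  shows "(\<lambda>n. half_exps N (s n) x) \<longlonglongrightarrow> half_exps N t x"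
  unfolding half_exps_def
proof (rule tendsto_prod)
  fix k assume k: "k \<in> {..<N}"
  then have lim: "(\<lambda>n. s n k) \<longlonglongrightarrow> t k" using assms by simp
  show "(\<lambda>n. half_exp (s n k) (x k)) \<longlonglongrightarrow> half_exp (t k) (x k)"
  proof (cases "x k \<le> t k")
    case True
    then have "half_exp (s n k) (x k) = exp (x k - s n k)" for n
      using assms(1)[of k n] k by (simp add: half_exp_def)
    then show ?thesis using True by (auto simp: half_exp_def intro!: tendsto_intros lim)
  next
    case False
    then have "\<forall>\<^sub>F n in sequentially. s n k < x k"
      using order_tendstoD(2)[OF lim] by simp
    then have "\<forall>\<^sub>F n in sequentially. half_exp (s n k) (x k) = 0"
      by eventually_elim (simp add: half_exp_def)
    then show ?thesis using False by (simp add: half_exp_def tendsto_eventually)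
  qed
qed

lemma half_exps_borel_measurable_point [measurable]:
  "(\<lambda>x. half_exps N t x) \<in> borel_measurable (l1_borel N)"
  unfolding half_exps_def by measurable

lemma half_exps_borel_measurable_params:
  "(\<lambda>t. half_exps N t y) \<in> borel_measurable (l1_borel N)"
  unfolding half_exps_def
proof (rule borel_measurable_prod)
  fix k assume "k \<in> {..<N}"
  then have [measurable]: "(\<lambda>t. t k) \<in> borel_measurable (l1_borel N)" by simp
  show "(\<lambda>t. half_exp (t k) (y k)) \<in> borel_measurable (l1_borel N)" by measurable
qed

lemma borel_measurable_exp_d1 [measurable]:
  "(\<lambda>x. exp (- d1 N x y)) \<in> borel_measurable (l1_borel N)"
  unfolding d1_def by measurable

lemma exp_minus_d1_bound: "\<bar>exp (- d1 N x y)\<bar> \<le> 1"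
  by (auto simp: d1_def intro!: sum_nonneg)

text \<open>The kernel is replaced by its integral representation and the integrals are exchanged.
  Everything is nonnegative, so this is done with \<open>nn_integral\<close>, and the integrability
  of \<open>g\<close> comes out as a by-product. Two different measures are allowed in order to
  treat the mixed term of the square of a difference.\<close>

lemma energy_representation:
  assumes A: "finite_measure A" "sets A = sets (l1_borel N)"
    and B: "finite_measure B" "sets B = sets (l1_borel N)"
  defines "L \<equiv> (\<Pi>\<^sub>M k\<in>{..<N}. lborel)"
  defines "g \<equiv> (\<lambda>t. (\<integral>x. half_exps N t x \<partial>A) * (\<integral>y. half_exps N t y \<partial>B))"
  shows "integrable L g"
    and "(\<integral>t. g t \<partial>L) = (\<integral>y. (\<integral>x. exp (- d1 N x y) \<partial>A) \<partial>B) / 2 ^ N"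
    and "(\<lambda>t. \<integral>x. half_exps N t x \<partial>A) \<in> borel_measurable L"
proof -
  interpret product_sigma_finite "\<lambda>_::nat. lborel :: real measure" by standard
  interpret L: sigma_finite_measure L unfolding L_def by (rule sigma_finite) simp
  interpret A: finite_measure A by fact
  interpret B: finite_measure B by fact
  interpret LA: pair_sigma_finite L A ..
  interpret LB: pair_sigma_finite L B ..
  have sL: "sets L = sets (l1_borel N)"
    unfolding L_def l1_borel_def by (intro sets_PiM_cong) auto
  have m1 [measurable]: "(\<lambda>p. half_exps N (fst p) (snd p)) \<in> borel_measurable (L \<Otimes>\<^sub>M A)"
  proof -
    have "(\<lambda>p. half_exps N (fst p) (snd p)) \<in> borel_measurable (l1_borel N \<Otimes>\<^sub>M l1_borel N)"
      unfolding half_exps_def by measurable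
    then show ?thesis using sets_pair_measure_cong[OF sL A(2)] measurable_cong_sets by blast
  qed
  have m2 [measurable]: "(\<lambda>p. half_exps N (fst p) (snd p)) \<in> borel_measurable (L \<Otimes>\<^sub>M B)"
  proof -
    have "(\<lambda>p. half_exps N (fst p) (snd p)) \<in> borel_measurable (l1_borel N \<Otimes>\<^sub>M l1_borel N)"
      unfolding half_exps_def by measurable
    then show ?thesis using sets_pair_measure_cong[OF sL B(2)] measurable_cong_sets by blast
  qed
  have mL [measurable]: "(\<lambda>t. half_exps N t y) \<in> borel_measurable L" for y
    using half_exps_borel_measurable_params sL measurable_cong_sets by blast
  have hA [measurable]: "half_exps N t \<in> borel_measurable A" and hB [measurable]: "half_exps N t \<in> borel_measurable B" for t
    using half_exps_borel_measurable_point A B measurable_cong_sets by blast+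
  have intA: "integrable A (half_exps N t)" for t
    by (rule A.integrable_bounded_real[where B = 1]) (auto simp: abs_le_iff half_exps_bounds intro: order_trans[OF _ half_exps_bounds(1)])
  have intB: "integrable B (half_exps N t)" for t
    by (rule B.integrable_bounded_real[where B = 1]) (auto simp: abs_le_iff half_exps_bounds intro: order_trans[OF _ half_exps_bounds(1)])
  have nA: "ennreal (\<integral>x. half_exps N t x \<partial>A) = (\<integral>\<^sup>+x. ennreal (half_exps N t x) \<partial>A)" for t
    by (rule nn_integral_eq_integral[OF intA, symmetric]) (simp add: half_exps_bounds)
  have nB: "ennreal (\<integral>x. half_exps N t x \<partial>B) = (\<integral>\<^sup>+x. ennreal (half_exps N t x) \<partial>B)" for t
    by (rule nn_integral_eq_integral[OF intB, symmetric]) (simp add: half_exps_bounds)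
  show mA: "(\<lambda>t. \<integral>x. half_exps N t x \<partial>A) \<in> borel_measurable L"
    using A.borel_measurable_lebesgue_integral[of "\<lambda>t x. half_exps N t x" L] m1 by (simp add: case_prod_beta')
  have mB: "(\<lambda>t. \<integral>x. half_exps N t x \<partial>B) \<in> borel_measurable L"
    using B.borel_measurable_lebesgue_integral[of "\<lambda>t x. half_exps N t x" L] m2 by (simp add: case_prod_beta')
  have gm: "g \<in> borel_measurable L" unfolding g_def using mA mB by measurable
  have g0: "0 \<le> g t" for t
    unfolding g_def by (intro mult_nonneg_nonneg Bochner_Integration.integral_nonneg half_exps_bounds)
  have mnA: "(\<lambda>p. \<integral>\<^sup>+x. ennreal (half_exps N (fst p) x) \<partial>A) \<in> borel_measurable (L \<Otimes>\<^sub>M B)"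
    unfolding nA[symmetric]
    by (rule measurable_compose[OF measurable_compose[OF measurable_fst mA] measurable_ennreal])
  have kA: "(\<lambda>x. exp (- d1 N x y)) \<in> borel_measurable A" for y
    using borel_measurable_exp_d1 A measurable_cong_sets by blast
  have intk: "integrable A (\<lambda>x. exp (- d1 N x y))" for y
    by (rule A.integrable_bounded_real[OF kA exp_minus_d1_bound])
  have kAB: "(\<lambda>y. \<integral>x. exp (- d1 N x y) \<partial>A) \<in> borel_measurable B"
  proof -
    have "(\<lambda>(y, x). exp (- d1 N x y)) \<in> borel_measurable (l1_borel N \<Otimes>\<^sub>M l1_borel N)"
      unfolding d1_def by measurable
    then have "(\<lambda>(y, x). exp (- d1 N x y)) \<in> borel_measurable (B \<Otimes>\<^sub>M A)"
      using sets_pair_measure_cong[OF B(2) A(2)] measurable_cong_sets by blast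
    then show ?thesis by (rule A.borel_measurable_lebesgue_integral)
  qed
  have kB: "\<bar>\<integral>x. exp (- d1 N x y) \<partial>A\<bar> \<le> measure A (space A)" for y
  proof -
    have "\<bar>\<integral>x. exp (- d1 N x y) \<partial>A\<bar> \<le> (\<integral>x. \<bar>exp (- d1 N x y)\<bar> \<partial>A)"
      using integral_abs_bound by blast
    also have "\<dots> \<le> (\<integral>x. 1 \<partial>A)"
      using intk exp_minus_d1_bound by (intro integral_mono) auto
    finally show ?thesis by simp
  qed
  have intkB: "integrable B (\<lambda>y. \<integral>x. exp (- d1 N x y) \<partial>A)"
    by (rule B.integrable_bounded_real[OF kAB kB])
  have "(\<integral>\<^sup>+t. ennreal (g t) \<partial>L) = (\<integral>\<^sup>+t. (\<integral>\<^sup>+y. (\<integral>\<^sup>+x. ennreal (half_exps N t x) \<partial>A) * ennreal (half_exps N t y) \<partial>B) \<partial>L)"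
    unfolding g_def
    by (intro nn_integral_cong)
      (simp add: ennreal_mult' nA nB nn_integral_cmult Bochner_Integration.integral_nonneg half_exps_bounds)
  also have "\<dots> = (\<integral>\<^sup>+y. (\<integral>\<^sup>+t. (\<integral>\<^sup>+x. ennreal (half_exps N t x) \<partial>A) * ennreal (half_exps N t y) \<partial>L) \<partial>B)"
    by (rule LB.Fubini'[symmetric]) (use mnA m2 in \<open>simp add: case_prod_beta'\<close>)
  also have "\<dots> = (\<integral>\<^sup>+y. (\<integral>\<^sup>+t. (\<integral>\<^sup>+x. ennreal (half_exps N t x * half_exps N t y) \<partial>A) \<partial>L) \<partial>B)"
    by (intro nn_integral_cong) (simp add: ennreal_mult half_exps_bounds nn_integral_multc)
  also have "\<dots> = (\<integral>\<^sup>+y. (\<integral>\<^sup>+x. (\<integral>\<^sup>+t. ennreal (half_exps N t x * half_exps N t y) \<partial>L) \<partial>A) \<partial>B)"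
    by (intro nn_integral_cong LA.Fubini'[symmetric]) (use m1 mL in \<open>simp add: case_prod_beta'\<close>)
  also have "\<dots> = (\<integral>\<^sup>+y. ennreal ((\<integral>x. exp (- d1 N x y) \<partial>A) / 2 ^ N) \<partial>B)"
    by (intro nn_integral_cong)
      (simp add: L_def nn_integral_half_exps nn_integral_eq_integral[OF integrable_divide[OF intk]])
  also have "\<dots> = ennreal ((\<integral>y. (\<integral>x. exp (- d1 N x y) \<partial>A) \<partial>B) / 2 ^ N)"
    by (subst nn_integral_eq_integral[OF integrable_divide[OF intkB]])
      (auto intro!: divide_nonneg_nonneg Bochner_Integration.integral_nonneg)
  finally have e: "(\<integral>\<^sup>+t. ennreal (g t) \<partial>L) = ennreal ((\<integral>y. (\<integral>x. exp (- d1 N x y) \<partial>A) \<partial>B) / 2 ^ N)" .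
  show "integrable L g"
    by (rule integrableI_nonneg[OF gm]) (use g0 e in auto)
  show "(\<integral>t. g t \<partial>L) = (\<integral>y. (\<integral>x. exp (- d1 N x y) \<partial>A) \<partial>B) / 2 ^ N"
    using gm g0 e
    by (subst integral_eq_nn_integral)
      (auto intro!: divide_nonneg_nonneg Bochner_Integration.integral_nonneg)
qed

lemma half_exps_eq: "half_exps N t x = (if \<forall>k<N. x k \<le> t k then exp (\<Sum>k<N. x k) / exp (\<Sum>k<N. t k) else 0)"
proof (cases "\<forall>k<N. x k \<le> t k")
  case True
  then show ?thesis
    by (auto simp: half_exps_def half_exp_def exp_diff exp_sum prod_dividef)
next
  case False
  then show ?thesis by (auto simp: half_exps_def half_exp_def not_le)
qed

text \<open>The open boxes with lower corner \<open>t\<close> and side \<open>1 / Suc n\<close> have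
  positive volume (1 if \<open>N = 0\<close>), so none of them consists of exceptional points
  only.\<close>

lemma ex_right_approx:
  assumes "AE t in (\<Pi>\<^sub>M k\<in>{..<N}. lborel). R t"
  obtains s :: "nat \<Rightarrow> nat \<Rightarrow> real" where "\<And>n. R (s n)" "\<And>n k. k < N \<Longrightarrow> t k < s n k"
    "\<And>k. k < N \<Longrightarrow> (\<lambda>n. s n k) \<longlonglongrightarrow> t k"
proof -
  let ?L = "\<Pi>\<^sub>M k\<in>{..<N}. lborel :: real measure"
  interpret product_sigma_finite "\<lambda>_::nat. lborel :: real measure" by standard
  have "\<exists>x. R x \<and> (\<forall>k<N. t k < x k \<and> x k < t k + 1 / real (Suc n))" for n
  proof (rule ccontr)
    assume no: "\<not> ?thesis"
    let ?B = "\<Pi>\<^sub>E k\<in>{..<N}. {t k<..<t k + 1 / real (Suc n)}"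
    have "AE x in ?L. x \<notin> ?B" using assms
    proof (rule eventually_mono)
      fix x assume "R x"
      then show "x \<notin> ?B" using no by (auto simp: PiE_iff)
    qed
    moreover have B: "?B \<in> sets ?L" by (intro sets_PiM_I_finite) auto
    ultimately have "emeasure ?L ?B = 0"
      using AE_iff_null_sets[OF B] by auto
    moreover have "emeasure ?L ?B = (\<Prod>k<N. ennreal (1 / real (Suc n)))"
      by (subst emeasure_PiM) auto
    ultimately show False by (simp add: prod_ennreal)
  qed
  then obtain s where s: "\<And>n. R (s n)" "\<And>n k. k < N \<Longrightarrow> t k < s n k"
    "\<And>n k. k < N \<Longrightarrow> s n k < t k + 1 / real (Suc n)"
    by metis
  have "(\<lambda>n. s n k) \<longlonglongrightarrow> t k" if "k < N" for k
  proof (rule tendsto_sandwich[where f = "\<lambda>_. t k" and h = "\<lambda>n. t k + 1 / real (Suc n)"])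
    show "(\<lambda>n. t k + 1 / real (Suc n)) \<longlonglongrightarrow> t k"
      using tendsto_add[OF tendsto_const LIMSEQ_inverse_real_of_nat, of "t k"] by (simp add: inverse_eq_divide)
    show "\<forall>\<^sub>F n in sequentially. t k \<le> s n k"
      using s(2)[OF that] by (intro always_eventually allI less_imp_le)
    show "\<forall>\<^sub>F n in sequentially. s n k \<le> t k + 1 / real (Suc n)"
      using s(3)[OF that] by (intro always_eventually allI less_imp_le)
  qed simp
  with s show thesis using that by blast
qed

lemma half_exps_integral_tendsto:
  assumes A: "finite_measure A" "sets A = sets (l1_borel N)"
    and "\<And>n k. k < N \<Longrightarrow> t k < s n k" "\<And>k. k < N \<Longrightarrow> (\<lambda>n. s n k) \<longlonglongrightarrow> t k"
  shows "(\<lambda>n. \<integral>x. half_exps N (s n) x \<partial>A) \<longlonglongrightarrow> (\<integral>x. half_exps N t x \<partial>A)"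
proof (rule integral_dominated_convergence[where w = "\<lambda>_. 1"])
  interpret finite_measure A by fact
  show "half_exps N t \<in> borel_measurable A" "\<And>n. half_exps N (s n) \<in> borel_measurable A"
    by (simp_all add: measurable_cong_sets[OF A(2) refl])
  show "integrable A (\<lambda>_. 1 :: real)" by simp
  show "AE x in A. (\<lambda>n. half_exps N (s n) x) \<longlonglongrightarrow> half_exps N t x"
    by (rule AE_I2) (rule half_exps_tendsto_right[OF assms(3,4)])
  show "AE x in A. norm (half_exps N (s n) x) \<le> 1" for n
    by (rule AE_I2) (simp add: half_exps_bounds abs_le_iff order_trans[OF _ half_exps_bounds(1)])
qed

text \<open>By \<open>half_exps_eq\<close>, the integrals are, up to a factor depending on
  \<open>t\<close>, the orthant masses of the measures with density \<open>f\<close>. These measures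
  are finite on orthants, although possibly not on the whole space, hence equal; multiplying by the
  reciprocal density recovers \<open>P\<close> and \<open>Q\<close>.\<close>

lemma finite_measure_eqI_half_exps:
  assumes P: "finite_measure P" "sets P = sets (l1_borel N)"
    and Q: "finite_measure Q" "sets Q = sets (l1_borel N)"
    and eq: "\<And>t. (\<integral>x. half_exps N t x \<partial>P) = (\<integral>x. half_exps N t x \<partial>Q)"
  shows "P = Q"
proof -
  define f :: "(nat \<Rightarrow> real) \<Rightarrow> ennreal" where "f x = ennreal (exp (\<Sum>k<N. x k))" for x
  have f [measurable]: "f \<in> borel_measurable (l1_borel N)" unfolding f_def by measurable
  have orth: "orthant N t \<in> sets (l1_borel N)" for t by (auto simp: sets_l1_borel)
  have E: "emeasure (density A f) (orthant N t) = ennreal (exp (\<Sum>k<N. t k) * (\<integral>x. half_exps N t x \<partial>A))"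
    if A: "finite_measure A" "sets A = sets (l1_borel N)" for A t
  proof -
    have fA: "f \<in> borel_measurable A" "half_exps N t \<in> borel_measurable A"
      by (simp_all add: measurable_cong_sets[OF A(2) refl])
    have spA: "space A = pts N" using sets_eq_imp_space_eq[OF A(2)] by simp
    have int: "integrable A (half_exps N t)"
      by (rule finite_measure.integrable_bounded_real[OF A(1) fA(2), of 1])
        (simp add: half_exps_bounds abs_le_iff order_trans[OF _ half_exps_bounds(1)])
    have "emeasure (density A f) (orthant N t) = (\<integral>\<^sup>+x. f x * indicator (orthant N t) x \<partial>A)"
      using fA orth A(2) by (simp add: emeasure_density)
    also have "\<dots> = (\<integral>\<^sup>+x. ennreal (exp (\<Sum>k<N. t k)) * ennreal (half_exps N t x) \<partial>A)"
      by (intro nn_integral_cong)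
        (auto simp: f_def half_exps_eq orthant_def spA ennreal_mult[symmetric] split: split_indicator)
    also have "\<dots> = ennreal (exp (\<Sum>k<N. t k)) * ennreal (\<integral>x. half_exps N t x \<partial>A)"
      using fA by (subst nn_integral_cmult) (auto simp: nn_integral_eq_integral[OF int] half_exps_bounds)
    finally show ?thesis
      by (simp add: ennreal_mult Bochner_Integration.integral_nonneg half_exps_bounds)
  qed
  have d: "density P f = density Q f"
    by (rule measure_eqI_orthant) (auto simp: P Q E eq)
  have inv: "density (density A f) (\<lambda>x. ennreal (exp (- (\<Sum>k<N. x k)))) = A"
    if A: "sets A = sets (l1_borel N)" for A
  proof -
    have "(\<lambda>x. ennreal (exp (- (\<Sum>k<N. x k)))) \<in> borel_measurable (l1_borel N)" by measurable
    then have "density (density A f) (\<lambda>x. ennreal (exp (- (\<Sum>k<N. x k)))) =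
      density A (\<lambda>x. f x * ennreal (exp (- (\<Sum>k<N. x k))))"
      using f by (intro density_density_eq) (simp_all add: measurable_cong_sets[OF A refl])
    also have "(\<lambda>x. f x * ennreal (exp (- (\<Sum>k<N. x k)))) = (\<lambda>_. 1)"
      by (simp add: f_def ennreal_mult[symmetric] exp_add[symmetric])
    finally show ?thesis by (simp add: density_1)
  qed
  show ?thesis
    using arg_cong[OF d, of "\<lambda>A. density A (\<lambda>x. ennreal (exp (- (\<Sum>k<N. x k))))"]
    unfolding inv[OF P(2)] inv[OF Q(2)] .
qed

text \<open>The energy of \<open>P - Q\<close> vanishes, and by the representation of the kernel it is the square of an
  \<open>L\<^sup>2\<close> norm.\<close>

lemma finite_measure_eqI_potential:
  assumes P: "finite_measure P" "sets P = sets (l1_borel N)" "AE x in P. x \<in> K"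
    and Q: "finite_measure Q" "sets Q = sets (l1_borel N)" "AE x in Q. x \<in> K"
    and eq: "\<And>y. y \<in> K \<Longrightarrow> (\<integral>x. exp (- d1 N x y) \<partial>P) = (\<integral>x. exp (- d1 N x y) \<partial>Q)"
  shows "P = Q"
proof (rule finite_measure_eqI_half_exps[OF P(1,2) Q(1,2)])
  let ?L = "\<Pi>\<^sub>M k\<in>{..<N}. lborel :: real measure"
  define p where "p t = (\<integral>x. half_exps N t x \<partial>P)" for t
  define q where "q t = (\<integral>x. half_exps N t x \<partial>Q)" for t
  define k where "k A B = (\<integral>y. (\<integral>x. exp (- d1 N x y) \<partial>A) \<partial>B)" for A B :: "(nat \<Rightarrow> real) measure"
  note PP = energy_representation[OF P(1,2) P(1,2), folded p_def k_def]
  note PQ = energy_representation[OF P(1,2) Q(1,2), folded p_def q_def k_def]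
  note QQ = energy_representation[OF Q(1,2) Q(1,2), folded q_def k_def]
  have pot: "(\<lambda>y. \<integral>x. exp (- d1 N x y) \<partial>A) \<in> borel_measurable B"
    if A: "finite_measure A" "sets A = sets (l1_borel N)" and B: "sets B = sets (l1_borel N)" for A B
  proof -
    interpret A: finite_measure A by fact
    have "(\<lambda>(y, x). exp (- d1 N x y)) \<in> borel_measurable (l1_borel N \<Otimes>\<^sub>M l1_borel N)"
      unfolding d1_def by measurable
    then have "(\<lambda>(y, x). exp (- d1 N x y)) \<in> borel_measurable (B \<Otimes>\<^sub>M A)"
      by (simp add: measurable_cong_sets[OF sets_pair_measure_cong[OF B A(2)] refl])
    then show ?thesis by (rule A.borel_measurable_lebesgue_integral)
  qed
  \<comment> \<open>The two potentials agree on \<open>K\<close>, and the outer integral, over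
    \<open>P\<close> or over \<open>Q\<close>, sees only \<open>K\<close>.\<close>
  have "k P P = k Q P" "k P Q = k Q Q"
    unfolding k_def using P Q eq by (auto intro!: integral_cong_AE pot elim!: eventually_mono)
  moreover have "k P Q = k Q P"
    using PQ(2) energy_representation(2)[OF Q(1,2) P(1,2), folded p_def q_def k_def]
    by (simp add: mult.commute)
  ultimately have k0: "k P P - 2 * k P Q + k Q Q = 0" by simp
  have sq: "(p t - q t)\<^sup>2 = p t * p t - 2 * (p t * q t) + q t * q t" for t
    by (simp add: power2_eq_square algebra_simps)
  have int: "integrable ?L (\<lambda>t. (p t - q t)\<^sup>2)"
    unfolding sq using PP(1) PQ(1) QQ(1)
    by (simp only: Bochner_Integration.integrable_add Bochner_Integration.integrable_diff integrable_mult_right)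
  have "(\<integral>t. (p t - q t)\<^sup>2 \<partial>?L) = (k P P - 2 * k P Q + k Q Q) / 2 ^ N"
  proof -
    have "(\<integral>t. (p t - q t)\<^sup>2 \<partial>?L) =
      (\<integral>t. p t * p t \<partial>?L) - 2 * (\<integral>t. p t * q t \<partial>?L) + (\<integral>t. q t * q t \<partial>?L)"
      unfolding sq using PP(1) PQ(1) QQ(1)
      by (simp only: Bochner_Integration.integral_add Bochner_Integration.integral_diff
          Bochner_Integration.integral_mult_right Bochner_Integration.integrable_add Bochner_Integration.integrable_diff integrable_mult_right)
    then show ?thesis by (simp add: PP(2) PQ(2) QQ(2) add_divide_distrib diff_divide_distrib)
  qed
  then have "AE t in ?L. (p t - q t)\<^sup>2 = 0"
    using integral_nonneg_eq_0_iff_AE[OF int] k0 by simp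
  then have ae: "AE t in ?L. p t = q t" by simp
  fix t
  \<comment> \<open>Passage from almost every parameter to the given one by approximation from the
    upper right.\<close>
  obtain s where s: "\<And>n. p (s n) = q (s n)" "\<And>n k. k < N \<Longrightarrow> t k < s n k"
    "\<And>k. k < N \<Longrightarrow> (\<lambda>n. s n k) \<longlonglongrightarrow> t k"
    using ex_right_approx[OF ae] by blast
  show "(\<integral>x. half_exps N t x \<partial>P) = (\<integral>x. half_exps N t x \<partial>Q)"
  proof (rule LIMSEQ_unique)
    show "(\<lambda>n. p (s n)) \<longlonglongrightarrow> (\<integral>x. half_exps N t x \<partial>P)"
      unfolding p_def by (rule half_exps_integral_tendsto[OF P(1,2) s(2,3)])
    show "(\<lambda>n. p (s n)) \<longlonglongrightarrow> (\<integral>x. half_exps N t x \<partial>Q)"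
      unfolding s(1) q_def by (rule half_exps_integral_tendsto[OF Q(1,2) s(2,3)])
  qed
qed

section \<open>Uniqueness of weight measures\<close>

lemma AE_pos_part_concentrated:
  assumes w: "finite_signed_measure M \<omega>" and K: "K \<in> sets M"
    and "\<And>A. A \<in> sets M \<Longrightarrow> \<omega> A = \<omega> (A \<inter> K)"
  shows "AE x in pos_part M \<omega>. x \<in> K"
proof (rule AE_I)
  have "\<omega> {} = 0" using w by (simp add: finite_signed_measure_def)
  have "\<omega> B = 0" if "B \<in> sets M" "B \<subseteq> space M - K" for B
  proof -
    have "B \<inter> K = {}" using that by blast
    then show ?thesis using assms(3)[OF that(1)] \<open>\<omega> {} = 0\<close> by simp
  qed
  then show "emeasure (pos_part M \<omega>) (space M - K) = 0"
    using K by (simp add: emeasure_pos_part[OF w] bot_ennreal[symmetric])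
qed (use K in auto)

lemma weight_measure_unique:
  assumes K: "K \<in> sets (l1_borel N)"
    and 1: "is_weight_measure N K \<omega>" and 2: "is_weight_measure N K \<eta>"
  shows "\<omega> = \<eta>"
proof -
  let ?M = "l1_borel N"
  have w: "finite_signed_measure ?M \<omega>" and h: "finite_signed_measure ?M \<eta>"
    using 1 2 by (auto simp: is_weight_measure_def)
  note d = finite_signed_measure_diff[OF w h]
  note d' = finite_signed_measure_uminus[OF d]
  have conc: "\<omega> A - \<eta> A = \<omega> (A \<inter> K) - \<eta> (A \<inter> K)" if "A \<in> sets ?M" for A
    using 1 2 that by (auto simp: is_weight_measure_def)
  \<comment> \<open>The difference of two weight measures has potential 0 on \<open>K\<close>. Its
    positive and negative parts are thus finite measures living on \<open>K\<close> with the same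
    potential there, and their equality makes the difference vanish.\<close>
  have "pos_part ?M (\<lambda>A. \<omega> A - \<eta> A) = pos_part ?M (\<lambda>A. - (\<omega> A - \<eta> A))"
  proof (rule finite_measure_eqI_potential[where K = K])
    fix y assume "y \<in> K"
    then have "signed_integral ?M (\<lambda>A. \<omega> A - \<eta> A) (\<lambda>x. exp (- d1 N x y)) = 0"
      using 1 2 by (subst signed_integral_diff[OF w h _ exp_minus_d1_bound]) (auto simp: is_weight_measure_def)
    then show "(\<integral>x. exp (- d1 N x y) \<partial>pos_part ?M (\<lambda>A. \<omega> A - \<eta> A)) =
      (\<integral>x. exp (- d1 N x y) \<partial>pos_part ?M (\<lambda>A. - (\<omega> A - \<eta> A)))"
      by (simp add: signed_integral_def)
  next
    show "AE x in pos_part ?M (\<lambda>A. \<omega> A - \<eta> A). x \<in> K"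
      by (rule AE_pos_part_concentrated[OF d K conc])
    show "AE x in pos_part ?M (\<lambda>A. - (\<omega> A - \<eta> A)). x \<in> K"
      by (rule AE_pos_part_concentrated[OF d' K]) (simp add: conc)
  qed (simp_all only: sets_pos_part finite_measure_pos_part[OF d] finite_measure_pos_part[OF d'])
  then have "\<omega> A = \<eta> A" if "A \<in> sets ?M" for A
    using Jordan_decomposition[OF d that] by simp
  moreover have "\<omega> A = \<eta> A" if "A \<notin> sets ?M" for A
    using w h that by (simp add: finite_signed_measure_def)
  ultimately show ?thesis by blast
qed

section \<open>Weight measures of boxes\<close>

text \<open>For \<open>a \<le> b\<close> this is the point of the interval nearest to
  \<open>x\<close>, so \<open>\<bar>clip a b x - x\<bar>\<close> is the distance from the
  interval.\<close>

definition clip :: "real \<Rightarrow> real \<Rightarrow> real \<Rightarrow> real" where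
  "clip a b x = max a (min b x)"

lemma borel_measurable_clip [measurable]: "clip a b \<in> borel_measurable borel"
  unfolding clip_def by measurable

text \<open>Pushing \<open>\<lambda> / 2\<close> on \<open>[a - 1, b + 1]\<close> forward along the retraction onto \<open>[a, b]\<close> turns the two
  overhanging unit intervals into the atoms at \<open>a\<close> and \<open>b\<close>.\<close>

definition ivl_measure :: "real \<Rightarrow> real \<Rightarrow> real measure" where
  "ivl_measure a b = distr (density lborel (\<lambda>x. ennreal (indicator {a - 1..b + 1} x / 2))) borel (clip a b)"

lemma sets_ivl_measure [simp, measurable_cong]: "sets (ivl_measure a b) = sets borel"
  by (simp add: ivl_measure_def)

lemma space_ivl_measure [simp]: "space (ivl_measure a b) = UNIV"
  by (simp add: ivl_measure_def)

text \<open>Allowing every \<open>A\<close> that contains the interval gives the total mass and the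
  concentration on the interval in one statement.\<close>

lemma emeasure_ivl_measure:
  assumes "a \<le> b" "{a..b} \<subseteq> A" "A \<in> sets borel"
  shows "emeasure (ivl_measure a b) A = ennreal (1 + (b - a) / 2)"
proof -
  have "clip a b -` A = UNIV" using assms by (force simp: clip_def)
  then have "emeasure (ivl_measure a b) A =
    (\<integral>\<^sup>+x. ennreal (indicator {a - 1..b + 1} x / 2) \<partial>lborel)"
    using assms by (simp add: ivl_measure_def emeasure_distr emeasure_density)
  also have "\<dots> = (\<integral>\<^sup>+x. ennreal (1 / 2) * indicator {a - 1..b + 1} x \<partial>lborel)"
    by (intro nn_integral_cong) (auto split: split_indicator)
  also have "\<dots> = ennreal (1 / 2) * ennreal (b + 1 - (a - 1))"
    using assms by (subst nn_integral_cmult_indicator) auto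
  also have "\<dots> = ennreal (1 / 2 * (b + 1 - (a - 1)))"
    using assms by (intro ennreal_mult[symmetric]) auto
  finally show ?thesis by (simp add: field_simps)
qed

lemma finite_measure_ivl_measure: "a \<le> b \<Longrightarrow> finite_measure (ivl_measure a b)"
  by standard (simp add: emeasure_ivl_measure)

text \<open>The overhanging unit intervals contribute \<open>exp (a - z)\<close> and
  \<open>exp (z - b)\<close>, just what the inner pieces \<open>1 - exp (a - z)\<close> and
  \<open>1 - exp (z - b)\<close> lack. The density 1/2 of \<open>ivl_measure\<close> later turns the
  2 into the potential 1.\<close>

lemma integral_exp_clip:
  fixes a b z :: real
  assumes "a \<le> z" "z \<le> b"
  shows "((\<lambda>x. exp (- \<bar>clip a b x - z\<bar>)) has_integral 2) {a - 1..b + 1}"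
proof -
  let ?f = "\<lambda>x. exp (- \<bar>clip a b x - z\<bar>)"
  have "((\<lambda>_. exp (a - z)) has_integral exp (a - z)) {a - 1..a}"
    using has_integral_const_real[of "exp (a - z)" "a - 1" a] by simp
  then have 1: "(?f has_integral exp (a - z)) {a - 1..a}"
    by (rule has_integral_eq[rotated]) (use assms in \<open>auto simp: clip_def\<close>)
  have "((\<lambda>_. exp (z - b)) has_integral exp (z - b)) {b..b + 1}"
    using has_integral_const_real[of "exp (z - b)" b "b + 1"] by simp
  then have 4: "(?f has_integral exp (z - b)) {b..b + 1}"
    by (rule has_integral_eq[rotated]) (use assms in \<open>auto simp: clip_def\<close>)
  have "((\<lambda>x. exp (x - z)) has_integral exp (z - z) - exp (a - z)) {a..z}"
    using assms by (intro fundamental_theorem_of_calculus)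
      (auto intro!: derivative_eq_intros simp flip: has_real_derivative_iff_has_vector_derivative)
  then have 2: "(?f has_integral exp (z - z) - exp (a - z)) {a..z}"
    by (rule has_integral_eq[rotated]) (use assms in \<open>auto simp: clip_def\<close>)
  have "((\<lambda>x. exp (z - x)) has_integral - exp (z - b) - - exp (z - z)) {z..b}"
    using assms by (intro fundamental_theorem_of_calculus)
      (auto intro!: derivative_eq_intros simp flip: has_real_derivative_iff_has_vector_derivative)
  then have 3: "(?f has_integral - exp (z - b) - - exp (z - z)) {z..b}"
    by (rule has_integral_eq[rotated]) (use assms in \<open>auto simp: clip_def\<close>)
  note c = has_integral_combine[OF _ _ has_integral_combine[OF _ _ has_integral_combine[OF _ _ 1 2] 3] 4]
  show ?thesis using c assms by simp
qed

text \<open>Every path from the interval to \<open>y\<close> passes through the nearest point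
  \<open>?z\<close>. The distances therefore add up, and the potential at \<open>y\<close> is the
  potential 1 at \<open>?z\<close> times the decay from \<open>?z\<close> to
  \<open>y\<close>.\<close>

lemma integral_ivl_measure:
  fixes a b y :: real
  assumes "a \<le> b"
  shows "(\<integral>x. exp (- \<bar>x - y\<bar>) \<partial>ivl_measure a b) = exp (- \<bar>clip a b y - y\<bar>)"
proof -
  let ?z = "clip a b y"
  have z: "a \<le> ?z" "?z \<le> b" using assms by (auto simp: clip_def)
  have split: "exp (- \<bar>clip a b x - y\<bar>) = exp (- \<bar>clip a b x - ?z\<bar>) * exp (- \<bar>?z - y\<bar>)" for x
  proof -
    have c: "a \<le> clip a b x" "clip a b x \<le> b" using assms by (auto simp: clip_def)
    consider "y < a" "?z = a" | "a \<le> y" "?z = y" | "b < y" "?z = b"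
      using assms by (force simp: clip_def)
    then have "\<bar>clip a b x - y\<bar> = \<bar>clip a b x - ?z\<bar> + \<bar>?z - y\<bar>"
      by cases (use c in auto)
    then show ?thesis by (simp add: exp_add[symmetric])
  qed
  have "continuous_on {a - 1..b + 1} (\<lambda>x. exp (- \<bar>clip a b x - ?z\<bar>))"
    unfolding clip_def by (intro continuous_intros)
  then have int: "(LBINT x:{a - 1..b + 1}. exp (- \<bar>clip a b x - ?z\<bar>)) = 2"
    using integral_exp_clip[OF z] by (simp add: set_borel_integral_eq_integral borel_integrable_atLeastAtMost' integral_unique)
  have "(\<integral>x. exp (- \<bar>x - y\<bar>) \<partial>ivl_measure a b) =
    (\<integral>x. (indicator {a - 1..b + 1} x / 2) * exp (- \<bar>clip a b x - y\<bar>) \<partial>lborel)"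
    unfolding ivl_measure_def by (subst integral_distr) (auto simp: integral_density)
  also have "\<dots> = (\<integral>x. (indicator {a - 1..b + 1} x * exp (- \<bar>clip a b x - ?z\<bar>)) * (exp (- \<bar>?z - y\<bar>) / 2) \<partial>lborel)"
    by (intro Bochner_Integration.integral_cong refl) (subst split, simp)
  also have "\<dots> = 2 * (exp (- \<bar>?z - y\<bar>) / 2)"
    using int by (simp only: Bochner_Integration.integral_mult_left_zero set_lebesgue_integral_def real_scaleR_def)
  finally show ?thesis by simp
qed

section \<open>Boxes in dimension N and their product measures\<close>

definition pbox :: "nat \<Rightarrow> (nat \<Rightarrow> real) \<Rightarrow> (nat \<Rightarrow> real) \<Rightarrow> (nat \<Rightarrow> real) set" where
  "pbox N a b = (\<Pi>\<^sub>E k\<in>{..<N}. {a k..b k})"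

text \<open>The minimum makes all factors finite measures, also those with index \<open>k \<ge> N\<close>, about which no
  order of \<open>a k\<close> and \<open>b k\<close> is assumed; the library's products need this.\<close>

definition box_measure :: "nat \<Rightarrow> (nat \<Rightarrow> real) \<Rightarrow> (nat \<Rightarrow> real) \<Rightarrow> (nat \<Rightarrow> real) measure" where
  "box_measure N a b = (\<Pi>\<^sub>M k\<in>{..<N}. ivl_measure (min (a k) (b k)) (b k))"

lemma sets_pbox [simp, intro]: "pbox N a b \<in> sets (l1_borel N)"
  unfolding pbox_def l1_borel_def by (intro sets_PiM_I_finite) auto

lemma compactin_pbox: "compactin (l1_top N) (pbox N a b)"
  unfolding pbox_def l1_top_def by (simp add: compactin_PiE)

lemma d1_set_pbox:
  assumes ab: "\<And>k. k < N \<Longrightarrow> a k \<le> b k"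
  shows "d1_set N (pbox N a b) y = (\<Sum>k<N. \<bar>clip (a k) (b k) (y k) - y k\<bar>)"
  unfolding d1_set_def
proof (rule cInf_eq_minimum)
  let ?c = "\<lambda>k\<in>{..<N}. clip (a k) (b k) (y k)"
  have "?c \<in> pbox N a b" using ab by (auto simp: pbox_def clip_def)
  moreover have "d1 N ?c y = (\<Sum>k<N. \<bar>clip (a k) (b k) (y k) - y k\<bar>)" by (simp add: d1_def)
  ultimately show "(\<Sum>k<N. \<bar>clip (a k) (b k) (y k) - y k\<bar>) \<in> (\<lambda>x. d1 N x y) ` pbox N a b"
    by (intro rev_image_eqI[of ?c]) simp_all
next
  fix v assume "v \<in> (\<lambda>x. d1 N x y) ` pbox N a b"
  then obtain x where x: "x \<in> pbox N a b" "v = d1 N x y" by blast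
  show "(\<Sum>k<N. \<bar>clip (a k) (b k) (y k) - y k\<bar>) \<le> v"
    unfolding x(2) d1_def
  proof (rule sum_mono)
    fix k assume "k \<in> {..<N}"
    then have "a k \<le> x k" "x k \<le> b k" using PiE_mem[OF x(1)[unfolded pbox_def]] by simp_all
    then show "\<bar>clip (a k) (b k) (y k) - y k\<bar> \<le> \<bar>x k - y k\<bar>"
      by (cases "y k < a k"; cases "b k < y k") (simp_all add: clip_def)
  qed
qed

context
  fixes N :: nat and a b :: "nat \<Rightarrow> real"
  assumes ab: "\<And>k. k < N \<Longrightarrow> a k \<le> b k"
begin

interpretation product_sigma_finite "\<lambda>k. ivl_measure (min (a k) (b k)) (b k)"
  by (rule product_sigma_finite.intro) (simp add: finite_measure_ivl_measure finite_measure.axioms(1))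

lemma sets_box_measure: "sets (box_measure N a b) = sets (l1_borel N)"
  unfolding box_measure_def l1_borel_def by (intro sets_PiM_cong) auto

lemma space_box_measure: "space (box_measure N a b) = pts N"
  using sets_eq_imp_space_eq[OF sets_box_measure] by simp

lemma emeasure_box_measure_PiE:
  assumes "\<And>k. k < N \<Longrightarrow> {a k..b k} \<subseteq> A k" "\<And>k. k < N \<Longrightarrow> A k \<in> sets borel"
  shows "emeasure (box_measure N a b) (Pi\<^sub>E {..<N} A) = ennreal (\<Prod>k<N. 1 + (b k - a k) / 2)"
proof -
  have "emeasure (box_measure N a b) (Pi\<^sub>E {..<N} A) = (\<Prod>k<N. ennreal (1 + (b k - a k) / 2))"
    unfolding box_measure_def using assms ab
    by (subst emeasure_PiM) (auto intro!: prod.cong simp: emeasure_ivl_measure min_absorb1)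
  also have "\<dots> = ennreal (\<Prod>k<N. 1 + (b k - a k) / 2)"
    by (rule prod_ennreal) (use ab in \<open>force intro: add_nonneg_nonneg\<close>)
  finally show ?thesis .
qed

lemma emeasure_box_measure_space:
  "emeasure (box_measure N a b) (pts N) = ennreal (\<Prod>k<N. 1 + (b k - a k) / 2)"
  unfolding pts_def by (rule emeasure_box_measure_PiE) auto

lemma finite_measure_box_measure: "finite_measure (box_measure N a b)"
  by standard (simp add: space_box_measure emeasure_box_measure_space)

lemma measure_box_measure_space:
  "measure (box_measure N a b) (pts N) = (\<Prod>k<N. 1 + (b k - a k) / 2)"
  unfolding measure_def emeasure_box_measure_space
  by (rule enn2real_ennreal, rule prod_nonneg) (use ab in \<open>force intro: add_nonneg_nonneg\<close>)

lemma measure_box_measure_Int: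
  assumes A: "A \<in> sets (l1_borel N)" and K: "K \<in> sets (l1_borel N)" "pbox N a b \<subseteq> K"
  shows "measure (box_measure N a b) (A \<inter> K) = measure (box_measure N a b) A"
proof (rule measure_eq_AE)
  interpret finite_measure "box_measure N a b" by (rule finite_measure_box_measure)
  have "emeasure (box_measure N a b) (pbox N a b) = emeasure (box_measure N a b) (pts N)"
    unfolding pbox_def by (subst emeasure_box_measure_PiE) (auto simp: emeasure_box_measure_space)
  then have "emeasure (box_measure N a b) (pts N - pbox N a b) = 0"
    using emeasure_compl[of "pbox N a b" "box_measure N a b"] emeasure_box_measure_space
    by (simp add: sets_box_measure space_box_measure)
  then have "AE x in box_measure N a b. x \<in> pbox N a b"
    by (intro AE_I[where N = "pts N - pbox N a b"])
      (use sets.compl_sets[OF sets_pbox] in \<open>auto simp: sets_box_measure space_box_measure\<close>)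
  then show "AE x in box_measure N a b. x \<in> A \<inter> K \<longleftrightarrow> x \<in> A"
    using K by (auto elim!: eventually_mono)
qed (use A K in \<open>auto simp: sets_box_measure\<close>)

text \<open>Holds also for \<open>y\<close> outside the box. This is the origin of the exponentials
  in the Fragment System: they are the potentials of the weight measures of cubes and faces at the
  corners.\<close>

lemma integral_box_measure:
  "(\<integral>x. exp (- d1 N x y) \<partial>box_measure N a b) = exp (- d1_set N (pbox N a b) y)"
proof -
  have "integrable (ivl_measure (min (a k) (b k)) (b k)) (\<lambda>x. exp (- \<bar>x - y k\<bar>))" for k
  proof (rule finite_measure.integrable_bounded_real[OF finite_measure_ivl_measure])
    have "(\<lambda>x. exp (- \<bar>x - y k\<bar>)) \<in> borel_measurable borel" by measurable
    then show "(\<lambda>x. exp (- \<bar>x - y k\<bar>)) \<in> borel_measurable (ivl_measure (min (a k) (b k)) (b k))"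
      by (simp add: measurable_cong_sets[OF sets_ivl_measure refl])
    show "\<bar>exp (- \<bar>x - y k\<bar>)\<bar> \<le> 1" for x by simp
  qed simp
  then have "(\<integral>x. exp (- d1 N x y) \<partial>box_measure N a b) =
    (\<Prod>k<N. \<integral>x. exp (- \<bar>x - y k\<bar>) \<partial>ivl_measure (min (a k) (b k)) (b k))"
    unfolding exp_minus_d1 box_measure_def by (intro product_integral_prod) auto
  also have "\<dots> = (\<Prod>k<N. exp (- \<bar>clip (a k) (b k) (y k) - y k\<bar>))"
    using ab by (intro prod.cong) (auto simp: integral_ivl_measure min_absorb1)
  also have "\<dots> = exp (- d1_set N (pbox N a b) y)"
    by (simp add: d1_set_pbox[OF ab] exp_sum sum_negf[symmetric])
  finally show ?thesis .
qed

end

section \<open>The Fragment System\<close>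

text \<open>The adjugate divided by the determinant is a two-sided inverse: as a right inverse it
  yields a solution, as a left inverse it shows that there is no other.\<close>

lemma ex1_solution_if_det_nonzero:
  fixes a :: "'a \<Rightarrow> 'a \<Rightarrow> real" and b :: "'a \<Rightarrow> real"
  assumes e: "bij_betw e {..<n} X" and d: "Determinant.det (mat n n (\<lambda>(i, j). a (e i) (e j))) \<noteq> 0"
  shows "\<exists>!x. x \<in> extensional X \<and> (\<forall>p\<in>X. (\<Sum>q\<in>X. a p q * x q) = b p)"
proof -
  let ?A = "mat n n (\<lambda>(i, j). a (e i) (e j))"
  let ?d = "Determinant.det ?A"
  define B where "B i j = adj_mat ?A $$ (i, j) / ?d" for i j
  have A: "?A \<in> carrier_mat n n" by simp
  note adj = adj_mat[OF A]
  have AB: "(\<Sum>k<n. a (e i) (e k) * B k j) = (if i = j then 1 else 0)" if "i < n" "j < n" for i j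
  proof -
    have "(?A * adj_mat ?A) $$ (i, j) = (?d \<cdot>\<^sub>m 1\<^sub>m n) $$ (i, j)" by (simp only: adj)
    then have "(\<Sum>k<n. a (e i) (e k) * adj_mat ?A $$ (k, j)) = (if i = j then ?d else 0)"
      using that adj(1) by (simp add: scalar_prod_def lessThan_atLeast0)
    then show ?thesis using d by (simp add: B_def sum_divide_distrib[symmetric])
  qed
  have BA: "(\<Sum>k<n. B i k * a (e k) (e j)) = (if i = j then 1 else 0)" if "i < n" "j < n" for i j
  proof -
    have "(adj_mat ?A * ?A) $$ (i, j) = (?d \<cdot>\<^sub>m 1\<^sub>m n) $$ (i, j)" by (simp only: adj)
    then have "(\<Sum>k<n. adj_mat ?A $$ (i, k) * a (e k) (e j)) = (if i = j then ?d else 0)"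
      using that adj(1) by (simp add: scalar_prod_def lessThan_atLeast0)
    then show ?thesis using d by (simp add: B_def sum_divide_distrib[symmetric])
  qed
  have X: "X = e ` {..<n}" using e by (simp add: bij_betw_def)
  have re: "(\<Sum>q\<in>X. f q) = (\<Sum>k<n. f (e k))" for f :: "'a \<Rightarrow> real"
    using e by (metis sum.reindex_bij_betw)
  define i where "i = the_inv_into {..<n} e"
  have i: "i (e k) = k" if "k < n" for k
    using e that by (simp add: i_def bij_betw_def the_inv_into_f_f)
  define x where "x = (\<lambda>p\<in>X. \<Sum>k<n. B (i p) k * b (e k))"
  show ?thesis
  proof (rule ex1I[of _ x])
    have "(\<Sum>q\<in>X. a p q * x q) = b p" if "p \<in> X" for p
    proof -
      obtain l where l: "l < n" "p = e l" using \<open>p \<in> X\<close> X by blast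
      have "(\<Sum>q\<in>X. a p q * x q) = (\<Sum>j<n. a (e l) (e j) * (\<Sum>k<n. B j k * b (e k)))"
        unfolding re using X by (intro sum.cong) (auto simp: x_def i l)
      also have "\<dots> = (\<Sum>j<n. \<Sum>k<n. a (e l) (e j) * B j k * b (e k))"
        by (simp add: sum_distrib_left mult.assoc)
      also have "\<dots> = (\<Sum>k<n. (\<Sum>j<n. a (e l) (e j) * B j k) * b (e k))"
        by (subst sum.swap) (simp add: sum_distrib_right)
      also have "\<dots> = (\<Sum>k<n. if l = k then b (e k) else 0)"
        using l by (intro sum.cong) (auto simp: AB)
      also have "\<dots> = b p" using l by simp
      finally show ?thesis .
    qed
    then show "x \<in> extensional X \<and> (\<forall>p\<in>X. (\<Sum>q\<in>X. a p q * x q) = b p)"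
      by (simp add: x_def)
  next
    fix y assume y: "y \<in> extensional X \<and> (\<forall>p\<in>X. (\<Sum>q\<in>X. a p q * y q) = b p)"
    have "y p = x p" if "p \<in> X" for p
    proof -
      obtain l where l: "l < n" "p = e l" using \<open>p \<in> X\<close> X by blast
      have "x p = (\<Sum>k<n. B l k * (\<Sum>q\<in>X. a (e k) q * y q))"
        unfolding x_def using that y X l by (auto simp: i intro!: sum.cong)
      also have "\<dots> = (\<Sum>k<n. \<Sum>j<n. B l k * a (e k) (e j) * y (e j))"
        unfolding re by (simp add: sum_distrib_left mult.assoc)
      also have "\<dots> = (\<Sum>j<n. (\<Sum>k<n. B l k * a (e k) (e j)) * y (e j))"
        by (subst sum.swap) (simp add: sum_distrib_right)
      also have "\<dots> = (\<Sum>j<n. if l = j then y (e j) else 0)"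
        using l by (intro sum.cong) (auto simp: BA)
      also have "\<dots> = y p" using l by simp
      finally show ?thesis by simp
    qed
    then show "y = x" using y by (intro extensionalityI[of y X x]) (auto simp: x_def)
  qed
qed

lemma finite_Dir [simp]: "finite (Dir N)"
  by (simp add: Dir_def finite_PiE)

lemma dotted_fragment_subset: "dotted_fragment N F q u \<subseteq> F \<times> Dir N"
  by (auto simp: dotted_fragment_def Let_def)

lemma solves_fragment_system_iff:
  assumes "finite F"
  shows "solves_fragment_system N F r x \<longleftrightarrow>
    (\<forall>z\<in>F \<times> Dir N. (\<Sum>w\<in>F \<times> Dir N. FS_entry N F r z w * x w) =
      (\<Sum>p\<in>fragment N F (fst z) (snd z). exp (- d1_set N (cube N p r) (corner N (fst z) (snd z) r))))"
proof -
  have "(\<Sum>w\<in>F \<times> Dir N. FS_entry N F r (q, u) w * x w) =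
    (\<Sum>(p, s)\<in>dotted_fragment N F q u. x (p, s) * exp (- d1_set N (face N p s r) (corner N q u r)))" for q u
    by (rule sum.mono_neutral_cong_right)
      (use assms dotted_fragment_subset[of N F q u] in \<open>auto simp: FS_entry_def mult.commute\<close>)
  then show ?thesis by (simp add: solves_fragment_system_def split_beta)
qed

lemma ex1_fragment_solution:
  assumes "finite F" and "r \<in> S_set N F"
  shows "\<exists>!x. x \<in> extensional (F \<times> Dir N) \<and> solves_fragment_system N F r x"
  unfolding solves_fragment_system_iff[OF assms(1)]
proof (rule ex1_solution_if_det_nonzero)
  show "bij_betw (from_nat_into (F \<times> Dir N)) {..<card (F \<times> Dir N)} (F \<times> Dir N)"
    using assms by (intro bij_betw_from_nat_into_finite) simp
  show "Determinant.det (mat (card (F \<times> Dir N)) (card (F \<times> Dir N)) (\<lambda>(i, j).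
    FS_entry N F r (from_nat_into (F \<times> Dir N) i) (from_nat_into (F \<times> Dir N) j))) \<noteq> 0"
    using assms(2) by (simp add: S_set_def FS_def Let_def)
qed

section \<open>Coordinate half-gap and directions\<close>

lemma cube_eq_pbox: "cube N p r = pbox N (\<lambda>k. p k - r) (\<lambda>k. p k + r)"
  by (simp add: cube_def pbox_def)

lemma face_eq_pbox: "face N p s r = pbox N (\<lambda>k. p k + r * Lf (s k)) (\<lambda>k. p k + r * Rf (s k))"
  by (simp add: face_def pbox_def)

text \<open>The zero direction, excluded from \<open>Dir N\<close>, stands for the cube, so that
  cubes are covered by the statements about faces.\<close>

lemma cube_eq_face: "cube N p r = face N p (\<lambda>_. 0) r"
  by (simp add: cube_def face_def Lf_def Rf_def)

lemma Lf_le_Rf: "Lf t \<le> Rf t"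
  by (simp add: Lf_def Rf_def)

lemma chg_gap:
  assumes F: "finite F" and pq: "p \<in> F" "q \<in> F" "k < N" "p k \<noteq> q k" and r: "ereal r < chg N F"
  shows "2 * r < \<bar>p k - q k\<bar>"
proof -
  let ?S = "{\<bar>p k - q k\<bar> | p q k. p \<in> F \<and> q \<in> F \<and> k < N} - {0}"
  have "\<not> card F \<le> 1" using pq F by (metis One_nat_def card_le_Suc0_iff_eq)
  then have r: "r < 1/2 * Min ?S" using r by (simp add: chg_def)
  have "?S \<subseteq> (\<lambda>(p, q, k). \<bar>p k - q k\<bar>) ` (F \<times> F \<times> {..<N})" by force
  then have "finite ?S" by (rule finite_subset) (simp add: F)
  moreover have "\<bar>p k - q k\<bar> \<in> ?S" using pq by auto
  ultimately have "Min ?S \<le> \<bar>p k - q k\<bar>" by (rule Min_le)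
  with r show ?thesis by simp
qed

text \<open>Ensures that the \<open>SOME\<close> in \<open>dotted_fragment\<close> picks an
  admissible \<open>g\<close>.\<close>

lemma chg_pos:
  assumes F: "finite F" "F \<subseteq> pts N"
  obtains g where "0 < g" "ereal g < chg N F"
proof (cases "card F \<le> 1")
  case True
  then show thesis using that[of 1] by (simp add: chg_def)
next
  case False
  let ?S = "{\<bar>p k - q k\<bar> | p q k. p \<in> F \<and> q \<in> F \<and> k < N} - {0}"
  obtain p q where pq: "p \<in> F" "q \<in> F" "p \<noteq> q"
    using False F by (metis One_nat_def card_le_Suc0_iff_eq)
  then obtain k where "k < N" "p k \<noteq> q k"
    using F PiE_ext[of p "{..<N}" "\<lambda>_. UNIV" q] by (force simp: pts_def)
  then have "\<bar>p k - q k\<bar> \<in> ?S" using pq by auto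
  then have ne: "?S \<noteq> {}" by (metis empty_iff)
  have "?S \<subseteq> (\<lambda>(p, q, k). \<bar>p k - q k\<bar>) ` (F \<times> F \<times> {..<N})" by force
  then have "finite ?S" by (rule finite_subset) (simp add: F)
  then have "Min ?S \<in> ?S" using ne by (rule Min_in)
  then have "0 < Min ?S" by auto
  then show thesis using that[of "Min ?S / 4"] False by (simp add: chg_def)
qed

text \<open>The direction \<open>u\<close> for which \<open>p\<close>, displaced infinitesimally by \<open>s\<close>, lies in the \<open>u\<close>-fragment
  at \<open>q\<close>.\<close>

definition dir_from :: "nat \<Rightarrow> (nat \<Rightarrow> real) \<Rightarrow> (nat \<Rightarrow> real) \<Rightarrow> (nat \<Rightarrow> real) \<Rightarrow> nat \<Rightarrow> real" where
  "dir_from N q p s = (\<lambda>k\<in>{..<N}. if p k = q k then s k else sgn (p k - q k))"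

lemma Dir_values: "s \<in> Dir N \<Longrightarrow> k < N \<Longrightarrow> s k \<in> {-1, 0, 1}"
  by (auto simp: Dir_def dest: PiE_mem)

lemma Dir_nonzero:
  assumes "u \<in> Dir N"
  obtains k where "k < N" "u k \<noteq> 0"
proof -
  have "\<exists>k<N. u k \<noteq> 0"
  proof (rule ccontr)
    assume "\<not> ?thesis"
    then have "u \<in> {..<N} \<rightarrow>\<^sub>E {0}"
      using assms by (intro PiE_I) (auto simp: Dir_def PiE_iff extensional_def)
    then show False using assms by (simp add: Dir_def)
  qed
  then show thesis using that by blast
qed

lemma eq_dir_from_iff:
  "u \<in> Dir N \<Longrightarrow> dir_from N q p s = u \<longleftrightarrow> (\<forall>k<N. (if p k = q k then s k else sgn (p k - q k)) = u k)"
  by (auto simp: dir_from_def Dir_def fun_eq_iff PiE_iff extensional_def)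

text \<open>The direction vanishes only if \<open>p\<close> and \<open>q\<close> agree in all
  coordinates and \<open>s\<close> is zero, which is the case of the cube of \<open>q\<close>
  itself.\<close>

lemma dir_from_in_Dir:
  assumes "p \<in> pts N" "q \<in> pts N" "\<And>k. k < N \<Longrightarrow> s k \<in> {-1, 0, 1}" and ne: "p \<noteq> q \<or> s \<in> Dir N"
  shows "dir_from N q p s \<in> Dir N"
proof -
  have "dir_from N q p s \<in> {..<N} \<rightarrow>\<^sub>E {-1, 0, 1}"
    using assms(3) by (force simp: dir_from_def sgn_if)
  moreover have "dir_from N q p s \<notin> {..<N} \<rightarrow>\<^sub>E {0}"
  proof
    assume "dir_from N q p s \<in> {..<N} \<rightarrow>\<^sub>E {0}"
    then have zero: "dir_from N q p s k = 0" if "k < N" for k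
      using PiE_mem[of "dir_from N q p s" "{..<N}" "\<lambda>_. {0}" k] that by simp
    have 0: "(if p k = q k then s k else sgn (p k - q k)) = 0" if "k < N" for k
      using zero[OF that] that by (simp add: dir_from_def)
    have pq: "p k = q k" if "k < N" for k using 0[OF that] by (auto split: if_splits simp: sgn_zero_iff)
    then have "p = q" using assms(1,2) by (intro PiE_ext[of p "{..<N}" "\<lambda>_. UNIV" q]) (auto simp: pts_def)
    then have "s \<in> Dir N" using ne by simp
    moreover have "s k = 0" if "k < N" for k using 0[OF that] pq[OF that] by simp
    ultimately show False using Dir_nonzero by metis
  qed
  ultimately show ?thesis by (simp add: Dir_def)
qed

text \<open>A displacement below the half-gap cannot change the sign of a nonzero coordinate
  difference; it matters only where \<open>p k = q k\<close>, and there the sign is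
  \<open>s k\<close>.\<close>

lemma dotted_fragment_eq:
  assumes F: "finite F" "F \<subseteq> pts N" and q: "q \<in> F" and u: "u \<in> Dir N"
  shows "dotted_fragment N F q u = {(p, s) \<in> F \<times> Dir N. dir_from N q p s = u}"
proof -
  define g where "g = (SOME g::real. 0 < g \<and> ereal g < chg N F)"
  have g: "0 < g" "ereal g < chg N F"
    using chg_pos[OF F] someI_ex[of "\<lambda>g::real. 0 < g \<and> ereal g < chg N F"] unfolding g_def by blast+
  have "sgn (p k + g * s k - q k) = (if p k = q k then s k else sgn (p k - q k))"
    if p: "p \<in> F" and s: "s \<in> Dir N" and k: "k < N" for p s k
  proof (cases "p k = q k")
    case True
    then show ?thesis using Dir_values[OF s k] g(1) by (auto simp: sgn_mult)
  next
    case False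
    have "2 * g < \<bar>p k - q k\<bar>" by (rule chg_gap[OF F(1) p q k False g(2)])
    then show ?thesis using Dir_values[OF s k] g(1) False by (auto simp: sgn_if)
  qed
  then have "(\<forall>k<N. sgn (p k + g * s k - q k) = u k) \<longleftrightarrow> dir_from N q p s = u"
    if "p \<in> F" "s \<in> Dir N" for p s
    using that by (simp add: eq_dir_from_iff[OF u])
  then show ?thesis
    unfolding dotted_fragment_def g_def[symmetric] Let_def by auto
qed

text \<open>As \<open>u\<close> is nonzero, \<open>q\<close> is never in its own fragment. With
  \<open>q\<close> removed explicitly, the fragments at \<open>q\<close> are the fibres of one map
  on \<open>F - {q}\<close>.\<close>

lemma fragment_eq:
  assumes u: "u \<in> Dir N"
  shows "fragment N F q u = {p \<in> F - {q}. dir_from N q p (\<lambda>_. 0) = u}"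
proof -
  obtain k where "k < N" "u k \<noteq> 0" using u by (rule Dir_nonzero)
  then have "dir_from N q q (\<lambda>_. 0) \<noteq> u" by (auto simp: eq_dir_from_iff[OF u])
  moreover have "(if p k = q k then 0 else sgn (p k - q k)) = sgn (p k - q k)" for p k by simp
  ultimately show ?thesis by (auto simp only: fragment_def eq_dir_from_iff[OF u])
qed

text \<open>If \<open>u k = 0\<close>, then \<open>p k = q k\<close> and \<open>s k = 0\<close>, so
  both \<open>y\<close> and the corner have their coordinate in the interval of the face. Otherwise
  that interval starts at the corner coordinate or lies beyond it as seen from \<open>y k\<close>,
  by degeneracy if \<open>p k = q k\<close> and by the gap if not. The extra distance then depends
  on \<open>u\<close>, \<open>q\<close> and \<open>y\<close> only.\<close>

lemma exp_minus_d1_set_face: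
  assumes F: "finite F" and p: "p \<in> F" and q: "q \<in> F" and r: "0 \<le> r" "ereal r < chg N F"
    and s: "\<And>k. k < N \<Longrightarrow> s k \<in> {-1, 0, 1}" and y: "y \<in> cube N q r"
  defines "u \<equiv> dir_from N q p s"
  shows "exp (- d1_set N (face N p s r) y) =
    exp (- d1_set N (face N p s r) (corner N q u r)) *
      (\<Prod>k<N. if u k = 0 then 1 else exp (- (r - u k * (y k - q k))))"
proof -
  have le: "p k + r * Lf (s k) \<le> p k + r * Rf (s k)" for k
    using r Lf_le_Rf by (simp add: mult_left_mono)
  have "\<bar>clip (p k + r * Lf (s k)) (p k + r * Rf (s k)) (y k) - y k\<bar> =
    \<bar>clip (p k + r * Lf (s k)) (p k + r * Rf (s k)) (corner N q u r k) - corner N q u r k\<bar> +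
      (if u k = 0 then 0 else r - u k * (y k - q k))" if k: "k < N" for k
  proof -
    have yk: "q k - r \<le> y k" "y k \<le> q k + r"
      using y k by (auto simp: cube_def PiE_iff)
    have u: "u k = (if p k = q k then s k else sgn (p k - q k))" using k by (simp add: u_def dir_from_def)
    have c: "corner N q u r k = q k + r * u k" using k by (simp add: corner_def)
    show ?thesis
    proof (cases "p k = q k")
      case True
      consider "s k = -1" | "s k = 0" | "s k = 1" using s[OF k] by blast
      then show ?thesis
        by cases (use True yk r in \<open>simp_all add: c u clip_def Lf_def Rf_def\<close>)
    next
      case False
      have gap: "2 * r < \<bar>p k - q k\<bar>" by (rule chg_gap[OF F p q k False r(2)])
      have LR: "- r \<le> r * Lf (s k)" "r * Rf (s k) \<le> r" "r * Lf (s k) \<le> r * Rf (s k)"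
        using r Lf_le_Rf by (auto simp: Lf_def Rf_def)
      show ?thesis
      proof (cases "p k > q k")
        case True
        then have "u k = 1" by (simp add: u)
        then show ?thesis unfolding c using gap LR yk True by (simp add: clip_def)
      next
        case False
        then have "u k = -1" using \<open>p k \<noteq> q k\<close> by (simp add: u)
        then show ?thesis unfolding c using gap LR yk False by (simp add: clip_def)
      qed
    qed
  qed
  then have "d1_set N (face N p s r) y = d1_set N (face N p s r) (corner N q u r) +
    (\<Sum>k<N. if u k = 0 then 0 else r - u k * (y k - q k))"
    unfolding face_eq_pbox by (simp add: d1_set_pbox[OF le] sum.distrib)
  moreover have "exp (- (\<Sum>k<N. if u k = 0 then 0 else r - u k * (y k - q k))) =
    (\<Prod>k<N. if u k = 0 then 1 else exp (- (r - u k * (y k - q k))))"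
    by (simp add: exp_sum sum_negf[symmetric] if_distrib[of exp] if_distrib[of uminus] cong: if_cong)
  ultimately show ?thesis by (simp only: minus_add_distrib exp_add)
qed

lemma fragment_potential:
  assumes F: "finite F" "F \<subseteq> pts N" and r: "0 \<le> r" "ereal r < chg N F"
    and sol: "solves_fragment_system N F r \<alpha>" and y: "y \<in> cubes N F r"
  shows "(\<Sum>p\<in>F. exp (- d1_set N (cube N p r) y)) -
    (\<Sum>(p, s)\<in>F \<times> Dir N. \<alpha> (p, s) * exp (- d1_set N (face N p s r) y)) = 1"
proof -
  obtain q where q: "q \<in> F" and yq: "y \<in> cube N q r" using y by (auto simp: cubes_def)
  define c where "c u = (\<Prod>k<N. if u k = 0 then 1 else exp (- (r - u k * (y k - q k))))" for u
  have Cq: "d1_set N (cube N q r) y = 0"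
  proof -
    have "clip (q k - r) (q k + r) (y k) = y k" if "k < N" for k
      using yq that by (auto simp: cube_def PiE_iff clip_def)
    then show ?thesis using r by (simp add: cube_eq_pbox d1_set_pbox)
  qed
  have split_face: "exp (- d1_set N (face N p s r) y) =
    exp (- d1_set N (face N p s r) (corner N q (dir_from N q p s) r)) * c (dir_from N q p s)"
    if "p \<in> F" "\<And>k. k < N \<Longrightarrow> s k \<in> {-1, 0, 1}" for p s
    unfolding c_def by (rule exp_minus_d1_set_face[OF F(1) that(1) q r that(2) yq])
  \<comment> \<open>Every cube other than that of \<open>q\<close> has a nonzero direction, so the
    directions in \<open>Dir N\<close> exhaust the sum.\<close>
  have "(\<Sum>p\<in>F - {q}. exp (- d1_set N (cube N p r) y)) =
    (\<Sum>u\<in>Dir N. \<Sum>p\<in>{p \<in> F - {q}. dir_from N q p (\<lambda>_. 0) = u}. exp (- d1_set N (cube N p r) y))"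
    by (rule sum.group[symmetric]) (use F q in \<open>auto intro!: dir_from_in_Dir\<close>)
  also have "\<dots> = (\<Sum>u\<in>Dir N. (\<Sum>p\<in>fragment N F q u. exp (- d1_set N (cube N p r) (corner N q u r))) * c u)"
    unfolding cube_eq_face by (auto simp: fragment_eq sum_distrib_right split_face intro!: sum.cong)
  \<comment> \<open>The equation with index \<open>(q, u)\<close>, multiplied by
    \<open>c u\<close>.\<close>
  also have "\<dots> = (\<Sum>u\<in>Dir N. (\<Sum>(p, s)\<in>dotted_fragment N F q u.
      \<alpha> (p, s) * exp (- d1_set N (face N p s r) (corner N q u r))) * c u)"
    using sol q by (intro sum.cong) (auto simp: solves_fragment_system_def)
  also have "\<dots> = (\<Sum>u\<in>Dir N. \<Sum>x\<in>{x \<in> F \<times> Dir N. dir_from N q (fst x) (snd x) = u}.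
      \<alpha> x * exp (- d1_set N (face N (fst x) (snd x) r) y))"
  proof (intro sum.cong refl)
    fix u assume u: "u \<in> Dir N"
    have df: "dotted_fragment N F q u = {x \<in> F \<times> Dir N. dir_from N q (fst x) (snd x) = u}"
      unfolding dotted_fragment_eq[OF F q u] by auto
    show "(\<Sum>(p, s)\<in>dotted_fragment N F q u.
      \<alpha> (p, s) * exp (- d1_set N (face N p s r) (corner N q u r))) * c u =
      (\<Sum>x\<in>{x \<in> F \<times> Dir N. dir_from N q (fst x) (snd x) = u}.
        \<alpha> x * exp (- d1_set N (face N (fst x) (snd x) r) y))"
      unfolding sum_distrib_right df
    proof (rule sum.cong[OF refl])
      fix x assume x: "x \<in> {x \<in> F \<times> Dir N. dir_from N q (fst x) (snd x) = u}"
      then have "exp (- d1_set N (face N (fst x) (snd x) r) y) =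
        exp (- d1_set N (face N (fst x) (snd x) r) (corner N q u r)) * c u"
        using split_face[of "fst x" "snd x"] Dir_values[of "snd x" N] by auto
      then show "(case x of (p, s) \<Rightarrow> \<alpha> (p, s) * exp (- d1_set N (face N p s r) (corner N q u r))) * c u =
        \<alpha> x * exp (- d1_set N (face N (fst x) (snd x) r) y)"
        by (simp add: split_beta)
    qed
  qed
  also have "\<dots> = (\<Sum>x\<in>F \<times> Dir N. \<alpha> x * exp (- d1_set N (face N (fst x) (snd x) r) y))"
    by (rule sum.group) (use F q in \<open>auto intro!: dir_from_in_Dir dest: Dir_values\<close>)
  \<comment> \<open>The term of \<open>q\<close> is left over; \<open>y\<close> lies in its cube, so
    it equals \<open>exp 0\<close>.\<close>
  finally show ?thesis
    using F q Cq by (simp add: sum.remove[of F q] split_beta)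
qed

section \<open>Unions of cubes\<close>

lemma is_weight_measureI:
  assumes "compactin (l1_top N) K" "finite_signed_measure (l1_borel N) \<omega>"
    "\<And>A. A \<in> sets (l1_borel N) \<Longrightarrow> \<omega> (A \<inter> K) = \<omega> A"
    "\<And>a. a \<in> K \<Longrightarrow> signed_integral (l1_borel N) \<omega> (\<lambda>x. exp (- d1 N x a)) = 1"
  shows "is_weight_measure N K \<omega>"
  using assms by (simp add: is_weight_measure_def)

lemma weight_measure_eqI:
  "K \<in> sets (l1_borel N) \<Longrightarrow> is_weight_measure N K \<omega> \<Longrightarrow> weight_measure N K = \<omega>"
  unfolding weight_measure_def by (blast intro: the_equality weight_measure_unique)

lemma weight_measure_pbox:
  assumes ab: "\<And>k. k < N \<Longrightarrow> a k \<le> b k"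
  shows "weight_measure N (pbox N a b) = measure (box_measure N a b)"
proof (rule weight_measure_eqI[OF sets_pbox], rule is_weight_measureI)
  note fin = finite_measure_box_measure[OF ab] and sets = sets_box_measure[OF ab]
  show w: "finite_signed_measure (l1_borel N) (measure (box_measure N a b))"
    by (rule finite_measure.finite_signed_measure_measure[OF fin]) (simp_all add: sets ab)
  show "measure (box_measure N a b) (A \<inter> pbox N a b) = measure (box_measure N a b) A"
    if "A \<in> sets (l1_borel N)" for A
    using that by (intro measure_box_measure_Int ab) auto
  fix y assume y: "y \<in> pbox N a b"
  have "signed_integral (l1_borel N) (measure (box_measure N a b)) (\<lambda>x. exp (- d1 N x y)) =
    (\<Sum>i\<in>{()}. 1 * (\<integral>x. exp (- d1 N x y) \<partial>box_measure N a b))"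
    by (rule signed_integral_sum_measures[OF _ _ w _ _ exp_minus_d1_bound])
      (auto simp: sets ab intro: fin)
  moreover have "clip (a k) (b k) (y k) = y k" if "k < N" for k
    using y that by (auto simp: pbox_def PiE_iff clip_def)
  ultimately show "signed_integral (l1_borel N) (measure (box_measure N a b)) (\<lambda>x. exp (- d1 N x y)) = 1"
    by (simp add: integral_box_measure ab d1_set_pbox)
qed (rule compactin_pbox)

section \<open>Weight measures of faces and their linear combinations\<close>

definition face_measure :: "nat \<Rightarrow> (nat \<Rightarrow> real) \<Rightarrow> (nat \<Rightarrow> real) \<Rightarrow> real \<Rightarrow> (nat \<Rightarrow> real) measure" where
  "face_measure N p s r = box_measure N (\<lambda>k. p k + r * Lf (s k)) (\<lambda>k. p k + r * Rf (s k))"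

context
  fixes r :: real
  assumes r: "0 \<le> r"
begin

lemma face_bounds: "p k + r * Lf (s k) \<le> p k + r * Rf (s k)"
  using r Lf_le_Rf by (simp add: mult_left_mono)

lemma weight_measure_face: "weight_measure N (face N p s r) = measure (face_measure N p s r)"
  unfolding face_eq_pbox face_measure_def by (rule weight_measure_pbox[OF face_bounds])

lemma sets_face_measure: "sets (face_measure N p s r) = sets (l1_borel N)"
  unfolding face_measure_def by (rule sets_box_measure[OF face_bounds])

lemma finite_measure_face_measure: "finite_measure (face_measure N p s r)"
  unfolding face_measure_def by (rule finite_measure_box_measure[OF face_bounds])

lemma finite_signed_measure_face: "finite_signed_measure (l1_borel N) (measure (face_measure N p s r))"
  by (rule finite_measure.finite_signed_measure_measure[OF finite_measure_face_measure])
    (simp add: sets_face_measure)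

lemma integral_face_measure:
  "(\<integral>x. exp (- d1 N x y) \<partial>face_measure N p s r) = exp (- d1_set N (face N p s r) y)"
  unfolding face_measure_def face_eq_pbox by (rule integral_box_measure[OF face_bounds])

lemma face_subset_cubes:
  assumes p: "p \<in> F"
  shows "face N p s r \<subseteq> cubes N F r"
proof -
  have LR: "- r \<le> r * Lf (s k)" "r * Rf (s k) \<le> r" for k
    using r by (auto simp: Lf_def Rf_def)
  have "{p k + r * Lf (s k)..p k + r * Rf (s k)} \<subseteq> {p k - r..p k + r}" for k
    using LR[of k] by auto
  then have "face N p s r \<subseteq> cube N p r"
    unfolding face_def cube_def by (intro PiE_mono)
  then show ?thesis using p by (auto simp: cubes_def)
qed

lemma sets_cubes: "finite F \<Longrightarrow> cubes N F r \<in> sets (l1_borel N)"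
  unfolding cubes_def cube_eq_pbox by (intro sets.finite_UN) auto

lemma measure_face_Int_cubes:
  assumes "finite F" "p \<in> F" "A \<in> sets (l1_borel N)"
  shows "measure (face_measure N p s r) (A \<inter> cubes N F r) = measure (face_measure N p s r) A"
  unfolding face_measure_def
  by (rule measure_box_measure_Int[OF face_bounds])
    (use assms sets_cubes face_subset_cubes in \<open>auto simp: face_eq_pbox\<close>)

text \<open>A free coordinate has an interval of length \<open>2 * r\<close> and contributes
  \<open>1 + r\<close>; a fixed one has a degenerate interval of mass 1.\<close>

lemma measure_face_cubes:
  assumes "finite F" "p \<in> F" and s: "\<And>k. k < N \<Longrightarrow> s k \<in> {-1, 0, 1}"
  shows "measure (face_measure N p s r) (cubes N F r) = (1 + r) ^ fdim N s"
proof -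
  have "cubes N F r \<subseteq> pts N" using sets.sets_into_space[OF sets_cubes[OF assms(1)]] by simp
  then have "measure (face_measure N p s r) (cubes N F r) = measure (face_measure N p s r) (pts N)"
    using measure_face_Int_cubes[OF assms(1,2), of "pts N" N s] sets.top[of "l1_borel N"] by (simp add: Int_absorb1)
  also have "\<dots> = (\<Prod>k<N. 1 + r * (Rf (s k) - Lf (s k)) / 2)"
    unfolding face_measure_def
    by (subst measure_box_measure_space) (simp_all add: r Lf_le_Rf mult_left_mono right_diff_distrib)
  also have "\<dots> = (\<Prod>k<N. if s k = 0 then 1 + r else 1)"
    using s by (intro prod.cong) (force simp: Lf_def Rf_def)+
  also have "\<dots> = (1 + r) ^ fdim N s"
    by (simp add: prod.If_cases fdim_def lessThan_def Int_def)
  finally show ?thesis .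
qed

text \<open>Integrated through its positive constituents, the combination has as potential the
  corresponding combination of face potentials, which \<open>fragment_potential\<close> evaluates to
  1.\<close>

lemma is_weight_measure_cubes:
  assumes F: "finite F" "F \<subseteq> pts N" and chg: "ereal r < chg N F"
    and sol: "solves_fragment_system N F r \<alpha>"
  shows "is_weight_measure N (cubes N F r) (\<lambda>A. (\<Sum>p\<in>F. measure (face_measure N p (\<lambda>_. 0) r) A)
    - (\<Sum>(p, s)\<in>F \<times> Dir N. \<alpha> (p, s) * measure (face_measure N p s r) A))"
proof (rule is_weight_measureI)
  let ?M = "l1_borel N"
  let ?C = "\<lambda>A. \<Sum>p\<in>F. measure (face_measure N p (\<lambda>_. 0) r) A"
  let ?D = "\<lambda>A. \<Sum>(p, s)\<in>F \<times> Dir N. \<alpha> (p, s) * measure (face_measure N p s r) A"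
  show "compactin (l1_top N) (cubes N F r)"
    unfolding cubes_def cube_eq_pbox by (rule compactin_Union) (use F in \<open>auto intro: compactin_pbox\<close>)
  have C: "finite_signed_measure ?M ?C"
    by (intro finite_signed_measure_sum finite_signed_measure_face)
  have D: "finite_signed_measure ?M ?D"
    unfolding split_beta
    by (intro finite_signed_measure_sum finite_signed_measure_scale finite_signed_measure_face)
  show "finite_signed_measure ?M (\<lambda>A. ?C A - ?D A)"
    by (rule finite_signed_measure_diff[OF C D])
  show "?C (A \<inter> cubes N F r) - ?D (A \<inter> cubes N F r) = ?C A - ?D A" if "A \<in> sets ?M" for A
    using that F
    by (intro arg_cong2[where f = minus] sum.cong) (auto simp: measure_face_Int_cubes)
  fix y assume y: "y \<in> cubes N F r"
  have "signed_integral ?M ?C (\<lambda>x. exp (- d1 N x y)) =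
    (\<Sum>p\<in>F. 1 * (\<integral>x. exp (- d1 N x y) \<partial>face_measure N p (\<lambda>_. 0) r))"
    by (rule signed_integral_sum_measures[OF _ _ C _ _ exp_minus_d1_bound])
      (auto simp: sets_face_measure finite_measure_face_measure)
  moreover have "signed_integral ?M ?D (\<lambda>x. exp (- d1 N x y)) =
    (\<Sum>w\<in>F \<times> Dir N. \<alpha> w * (\<integral>x. exp (- d1 N x y) \<partial>face_measure N (fst w) (snd w) r))"
    by (rule signed_integral_sum_measures[OF _ _ D _ _ exp_minus_d1_bound])
      (auto simp: sets_face_measure finite_measure_face_measure split_beta)
  ultimately show "signed_integral ?M (\<lambda>A. ?C A - ?D A) (\<lambda>x. exp (- d1 N x y)) = 1"
    using fragment_potential[OF F r chg sol y]
    by (subst signed_integral_diff[OF C D _ exp_minus_d1_bound])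
      (auto simp: integral_face_measure split_beta cube_eq_face[symmetric])
qed

end

theorem theorem6p1:
  fixes N :: nat and F :: "(nat \<Rightarrow> real) set"
  assumes "F \<subseteq> pts N" and "finite F" and "F \<noteq> {}"
  shows "(\<forall>r \<in> S_set N F.
            \<exists>!x. x \<in> extensional (F \<times> Dir N) \<and> solves_fragment_system N F r x) \<and>
         (\<forall>r \<in> S_set N F. r > 0 \<longrightarrow>
            (\<exists>!\<omega>. is_weight_measure N (cubes N F r) \<omega>) \<and>
            weight_measure N (cubes N F r) =
              (\<lambda>A. (\<Sum>p\<in>F. weight_measure N (cube N p r) A)
                 - (\<Sum>(p, s) \<in> F \<times> Dir N.
                      fs_solution N F r (p, s) * weight_measure N (face N p s r) A)) \<and>
            mag N (cubes N F r) =
              real (card F) * (1 + r) ^ N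
                - (\<Sum>(p, s) \<in> F \<times> Dir N. fs_solution N F r (p, s) * (1 + r) ^ fdim N s))"
proof (intro conjI ballI impI)
  show "\<exists>!x. x \<in> extensional (F \<times> Dir N) \<and> solves_fragment_system N F r x" if "r \<in> S_set N F" for r
    by (rule ex1_fragment_solution[OF assms(2) that])
  fix r assume S: "r \<in> S_set N F" and "r > 0"
  then have r: "0 \<le> r" "ereal r < chg N F" by (simp_all add: S_set_def)
  let ?\<omega> = "\<lambda>A. (\<Sum>p\<in>F. weight_measure N (cube N p r) A)
    - (\<Sum>(p, s) \<in> F \<times> Dir N. fs_solution N F r (p, s) * weight_measure N (face N p s r) A)"
  have "solves_fragment_system N F r (fs_solution N F r)"
    unfolding fs_solution_def using theI'[OF ex1_fragment_solution[OF assms(2) S]] by blast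
  then have w: "is_weight_measure N (cubes N F r) ?\<omega>"
    using is_weight_measure_cubes[OF r(1) assms(2,1) r(2)]
    by (simp add: cube_eq_face weight_measure_face[OF r(1)])
  note K = sets_cubes[OF r(1) assms(2)]
  show "\<exists>!\<omega>. is_weight_measure N (cubes N F r) \<omega>"
    using w weight_measure_unique[OF K] by blast
  show wm: "weight_measure N (cubes N F r) = ?\<omega>"
    by (rule weight_measure_eqI[OF K w])
  have m: "measure (face_measure N p s r) (cubes N F r) = (1 + r) ^ fdim N s" if "p \<in> F" "s \<in> Dir N" for p s
    using measure_face_cubes[OF r(1) assms(2) that(1)] Dir_values[OF that(2)] by blast
  \<comment> \<open>Cubes enter as faces of direction 0, whose masses are then
    \<open>(1 + r) ^ N\<close>.\<close>
  have "fdim N (\<lambda>_. 0) = N" by (simp add: fdim_def)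
  moreover have "(\<Sum>(p, s) \<in> F \<times> Dir N. fs_solution N F r (p, s) * weight_measure N (face N p s r) (cubes N F r)) =
    (\<Sum>(p, s) \<in> F \<times> Dir N. fs_solution N F r (p, s) * (1 + r) ^ fdim N s)"
    by (rule sum.cong) (auto simp: weight_measure_face[OF r(1)] m)
  ultimately show "mag N (cubes N F r) = real (card F) * (1 + r) ^ N
    - (\<Sum>(p, s) \<in> F \<times> Dir N. fs_solution N F r (p, s) * (1 + r) ^ fdim N s)"
    unfolding mag_def wm
    by (simp add: cube_eq_face weight_measure_face[OF r(1)] measure_face_cubes[OF r(1) assms(2)])
qed

end
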